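(* Let $L>0$, $T>0$, $1<\alpha\le 2$, $0<\beta<1$, $\mathcal{K}_{\alpha}>0$, $\mathcal{K}_{\beta}\ge 0$, and let $p\in\{2,4,6,8,10,12\}$. Consider the problem $$\frac{\partial u(x,t)}{\partial t}=\mathcal{K}_{\alpha}\frac{\partial^{\alpha}u(x,t)}{\partial |x|^{\alpha}}+\mathcal{K}_{\beta}\frac{\partial^{\beta}u(x,t)}{\partial |x|^{\beta}},\quad 0<x<L,\ 0\le t\le T,$$ $$u(x,0)=\psi(x),\ 0\le x\le L,\qquad u(0,t)=u(L,t)=0,\ 0\le t\le T,$$ with Riesz space fractional derivatives. For positive integers $m\ge 2$ and $n$, put $h=L/m$, $k=T/n$, $t_j=jk$, and let $S=A^{(\alpha)}M^{(\alpha)}+A^{(\beta)}M^{(\beta)}$ be the $(m-1)\times(m-1)$ matrix defined in the context. Then the iterative scheme for this problem $$U(t_{j+1})=\bigl(120I+60kS+12(kS)^2+(kS)^3\bigr)^{-1}\bigl(120I-60kS+12(kS)^2-(kS)^3\bigr)U(t_j),\quad j=0,1,\dots,n-1,$$ with $U(t_0)=U_0=(\psi(h),\psi(2h),\dots,\psi((m-1)h))^{T}$ and $I$ the identity matrix, is unconditionally stable.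
   Context: Riesz derivative. For $n_0-1<\nu\le n_0$, $n_0\in\mathbb{N}$, $\nu\ne 1$, the Riesz fractional derivative of order $\nu$ on $[0,L]$ is $$\frac{d^{\nu}f(x)}{d|x|^{\nu}}=-\frac{1}{2\cos(\pi\nu/2)}\bigl\{{}_0D_x^{\nu}f(x)+{}_xD_L^{\nu}f(x)\bigr\},$$ where ${}_0D_x^{\nu}f(x)=\frac{1}{\Gamma(n_0-\nu)}\frac{d^{n_0}}{dx^{n_0}}\int_0^x\frac{f(\xi)}{(x-\xi)^{\nu-n_0+1}}d\xi$ and ${}_xD_L^{\nu}f(x)=\frac{(-1)^{n_0}}{\Gamma(n_0-\nu)}\frac{d^{n_0}}{dx^{n_0}}\int_x^L\frac{f(\xi)}{(\xi-x)^{\nu-n_0+1}}d\xi$ are the left and right Riemann-Liouville derivatives. Matrices. For $\nu\in\{\alpha,\beta\}$ and $i,j=1,\dots,m-1$, $$A^{(\nu)}_{i,j}=\vartheta^{(\nu)}_{|i-j|,p},\qquad M^{(\nu)}_{i,j}=\mathcal{K}_{\nu}h^{-\nu}\omega^{(\nu)}_{|i-j|},$$ where $$\omega_r^{(\nu)}=\frac{(-1)^{r}\Gamma(\nu+1)}{\Gamma(\frac{\nu}{2}-r+1)\Gamma(\frac{\nu}{2}+r+1)},\quad r\in\mathbb{Z}$$ (with $1/\Gamma$ equal to $0$ at non-positive integers), and the coefficients $\vartheta_{s,p}^{(\nu)}=\vartheta_{-s,p}^{(\nu)}$ are as follows, all coefficients not listed being zero. $p=2$: $\vartheta_{0,2}^{(\nu)}=1$.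 $p=4$: $\vartheta_{1,4}^{(\nu)}=-\frac{\nu}{24}$, $\vartheta_{0,4}^{(\nu)}=\frac{\nu}{12}+1$. $p=6$: $\vartheta_{2,6}^{(\nu)}=(\frac{\nu}{1152}+\frac{11}{2880})\nu$, $\vartheta_{1,6}^{(\nu)}=-(\frac{\nu}{288}+\frac{41}{720})\nu$, $\vartheta_{0,6}^{(\nu)}=\frac{\nu^2}{192}+\frac{17\nu}{160}+1$. $p=8$: $\vartheta_{3,8}^{(\nu)}=-(\frac{\nu^2}{82944}+\frac{11\nu}{69120}+\frac{191}{362880})\nu$, $\vartheta_{2,8}^{(\nu)}=(\frac{\nu^2}{13824}+\frac{7\nu}{3840}+\frac{211}{30240})\nu$, $\vartheta_{1,8}^{(\nu)}=-(\frac{5\nu^2}{27648}+\frac{3\nu}{512}+\frac{7843}{120960})\nu$, $\vartheta_{0,8}^{(\nu)}=\frac{5\nu^3}{20736}+\frac{29\nu^2}{3456}+\frac{5297\nu}{45360}+1$. $p=10$: $\vartheta_{4,10}^{(\nu)}=(\frac{\nu^3}{7962624}+\frac{11\nu^2}{3317760}+\frac{10181\nu}{348364800}+\frac{2497}{29030400})\nu$, $\vartheta_{3,10}^{(\nu)}=-(\frac{\nu^3}{995328}+\frac{\nu^2}{25920}+\frac{17111\nu}{43545600}+\frac{1469}{1209600})\nu$, $\vartheta_{2,10}^{(\nu)}=(\frac{7\nu^3}{1990656}+\frac{137\nu^2}{829440}+\frac{32861\nu}{12441600}+\frac{68119}{7257600})\nu$, $\vartheta_{1,10}^{(\nu)}=-(\frac{7\nu^3}{995328}+\frac{19\nu^2}{51840}+\frac{46631\nu}{6220800}+\frac{252769}{3628800})\nu$,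 $\vartheta_{0,10}^{(\nu)}=\frac{35\nu^4}{3981312}+\frac{157\nu^3}{331776}+\frac{51941\nu^2}{4976640}+\frac{118829\nu}{967680}+1$. $p=12$: $\vartheta_{5,12}^{(\nu)}=-(\frac{\nu^4}{955514880}+\frac{11\nu^3}{238878720}+\frac{6361\nu^2}{8360755200}+\frac{11693\nu}{2090188800}+\frac{14797}{958003200})\nu$, $\vartheta_{4,12}^{(\nu)}=(\frac{\nu^4}{95551488}+\frac{7\nu^3}{11943936}+\frac{9133\nu^2}{836075520}+\frac{5563\nu}{65318400}+\frac{230371}{958003200})\nu$, $\vartheta_{3,12}^{(\nu)}=-(\frac{\nu^4}{21233664}+\frac{49\nu^3}{15925248}+\frac{13529\nu^2}{185794560}+\frac{449171\nu}{696729600}+\frac{203257}{106444800})\nu$, $\vartheta_{2,12}^{(\nu)}=(\frac{\nu^4}{7962624}+\frac{\nu^3}{110592}+\frac{17869\nu^2}{69672960}+\frac{24041\nu}{7257600}+\frac{299093}{26611200})\nu$, $\vartheta_{1,12}^{(\nu)}=-(\frac{7\nu^4}{31850496}+\frac{133\nu^3}{7962624}+\frac{20953\nu^2}{39813120}+\frac{431513\nu}{49766400}+\frac{11639731}{159667200})\nu$, $\vartheta_{0,12}^{(\nu)}=\frac{7\nu^5}{26542080}+\frac{203\nu^4}{9953280}+\frac{22061\nu^3}{33177600}+\frac{2303\nu^2}{194400}+\frac{6742753\nu}{53222400}+1$. Stability. Stability is understood with respect to the discrete norm $\|V\|_{2,h}=\bigl(h\sum_{i=1}^{m-1}|V_i|^2\bigr)^{1/2}$: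 a one-step scheme $U(t_{j+1})=QU(t_j)$, with $Q$ depending on $h$ and $k$, is stable if there are non-negative constants $K$ and $C$, independent of $h$, $k$ and $j$, such that $\|U(t_j)\|_{2,h}\le K e^{Ct_j}\|U(t_0)\|_{2,h}$ for all $j$ and all initial vectors $U(t_0)$. It is unconditionally stable if this holds with no restriction relating the step sizes $h$ and $k$. *)

theory Defs
  imports
    "HOL-Analysis.Gamma_Function"
    "Jordan_Normal_Form.Gauss_Jordan_Elimination"
begin

(* rGamma is the entire function 1/Gamma, so it vanishes at the non-positive integers. *)
definition omega :: "real \<Rightarrow> int \<Rightarrow> real" where
  "omega \<nu> r =
     (-1) powi r * Gamma (\<nu> + 1) * rGamma (\<nu> / 2 - of_int r + 1) * rGamma (\<nu> / 2 + of_int r + 1)"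

(* The coefficients with index 0, 1, ..., p/2 - 1, in this order. *)
definition vartheta_list :: "nat \<Rightarrow> real \<Rightarrow> real list" where
  "vartheta_list p \<nu> =
    (if p = 2 then
       [1]
     else if p = 4 then
       [\<nu> / 12 + 1,
        - (\<nu> / 24)]
     else if p = 6 then
       [\<nu>^2 / 192 + 17 * \<nu> / 160 + 1,
        - (\<nu> / 288 + 41 / 720) * \<nu>,
        (\<nu> / 1152 + 11 / 2880) * \<nu>]
     else if p = 8 then
       [5 * \<nu>^3 / 20736 + 29 * \<nu>^2 / 3456 + 5297 * \<nu> / 45360 + 1,
        - (5 * \<nu>^2 / 27648 + 3 * \<nu> / 512 + 7843 / 120960) * \<nu>,
        (\<nu>^2 / 13824 + 7 * \<nu> / 3840 + 211 / 30240) * \<nu>,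
        - (\<nu>^2 / 82944 + 11 * \<nu> / 69120 + 191 / 362880) * \<nu>]
     else if p = 10 then
       [35 * \<nu>^4 / 3981312 + 157 * \<nu>^3 / 331776 + 51941 * \<nu>^2 / 4976640
          + 118829 * \<nu> / 967680 + 1,
        - (7 * \<nu>^3 / 995328 + 19 * \<nu>^2 / 51840 + 46631 * \<nu> / 6220800 + 252769 / 3628800) * \<nu>,
        (7 * \<nu>^3 / 1990656 + 137 * \<nu>^2 / 829440 + 32861 * \<nu> / 12441600 + 68119 / 7257600) * \<nu>,
        - (\<nu>^3 / 995328 + \<nu>^2 / 25920 + 17111 * \<nu> / 43545600 + 1469 / 1209600) * \<nu>,
        (\<nu>^3 / 7962624 + 11 * \<nu>^2 / 3317760 + 10181 * \<nu> / 348364800 + 2497 / 29030400) * \<nu>]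
     else if p = 12 then
       [7 * \<nu>^5 / 26542080 + 203 * \<nu>^4 / 9953280 + 22061 * \<nu>^3 / 33177600
          + 2303 * \<nu>^2 / 194400 + 6742753 * \<nu> / 53222400 + 1,
        - (7 * \<nu>^4 / 31850496 + 133 * \<nu>^3 / 7962624 + 20953 * \<nu>^2 / 39813120
          + 431513 * \<nu> / 49766400 + 11639731 / 159667200) * \<nu>,
        (\<nu>^4 / 7962624 + \<nu>^3 / 110592 + 17869 * \<nu>^2 / 69672960
          + 24041 * \<nu> / 7257600 + 299093 / 26611200) * \<nu>,
        - (\<nu>^4 / 21233664 + 49 * \<nu>^3 / 15925248 + 13529 * \<nu>^2 / 185794560
          + 449171 * \<nu> / 696729600 + 203257 / 106444800) * \<nu>,
        (\<nu>^4 / 95551488 + 7 * \<nu>^3 / 11943936 + 9133 * \<nu>^2 / 836075520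
          + 5563 * \<nu> / 65318400 + 230371 / 958003200) * \<nu>,
        - (\<nu>^4 / 955514880 + 11 * \<nu>^3 / 238878720 + 6361 * \<nu>^2 / 8360755200
          + 11693 * \<nu> / 2090188800 + 14797 / 958003200) * \<nu>]
     else [])"

definition vartheta :: "real \<Rightarrow> nat \<Rightarrow> int \<Rightarrow> real" where
  "vartheta \<nu> p s =
     (let cs = vartheta_list p \<nu> in if nat \<bar>s\<bar> < length cs then cs ! nat \<bar>s\<bar> else 0)"

(* Matrix indices run over 0, ..., m - 2 instead of 1, ..., m - 1; the entries below depend
   only on the difference of the indices. *)
definition A_mat :: "nat \<Rightarrow> real \<Rightarrow> nat \<Rightarrow> real mat" where
  "A_mat p \<nu> m = mat (m - 1) (m - 1) (\<lambda>(i, j). vartheta \<nu> p \<bar>int i - int j\<bar>)"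

definition M_mat :: "real \<Rightarrow> real \<Rightarrow> real \<Rightarrow> nat \<Rightarrow> real mat" where
  "M_mat \<K> \<nu> h m = mat (m - 1) (m - 1) (\<lambda>(i, j). \<K> * h powr (-\<nu>) * omega \<nu> \<bar>int i - int j\<bar>)"

definition S_mat ::
    "nat \<Rightarrow> real \<Rightarrow> real \<Rightarrow> real \<Rightarrow> real \<Rightarrow> real \<Rightarrow> nat \<Rightarrow> real mat" where
  "S_mat p \<alpha> \<beta> \<K>\<alpha> \<K>\<beta> h m =
     A_mat p \<alpha> m * M_mat \<K>\<alpha> \<alpha> h m + A_mat p \<beta> m * M_mat \<K>\<beta> \<beta> h m"

definition pade_den :: "real mat \<Rightarrow> real mat" where
  "pade_den X = 120 \<cdot>\<^sub>m 1\<^sub>m (dim_row X) + 60 \<cdot>\<^sub>m X + 12 \<cdot>\<^sub>m (X ^\<^sub>m 2) + X ^\<^sub>m 3"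

definition pade_num :: "real mat \<Rightarrow> real mat" where
  "pade_num X = 120 \<cdot>\<^sub>m 1\<^sub>m (dim_row X) - 60 \<cdot>\<^sub>m X + 12 \<cdot>\<^sub>m (X ^\<^sub>m 2) - X ^\<^sub>m 3"

(* mat_inverse returns None on a singular matrix, so this is meaningful only together with
   the invertibility of pade_den X. *)
definition pade_step :: "real mat \<Rightarrow> real mat" where
  "pade_step X = the (mat_inverse (pade_den X)) * pade_num X"

definition norm2h :: "real \<Rightarrow> real vec \<Rightarrow> real" where
  "norm2h h V = sqrt (h * (\<Sum>i<dim_vec V. \<bar>V $ i\<bar>^2))"

(* Q m n is the step matrix for the step sizes h = L/m and k = T/n.  The pairs (m, n) are
   unrestricted, so no relation between h and k is imposed. *)
definition unconditionally_stable :: "real \<Rightarrow> real \<Rightarrow> (nat \<Rightarrow> nat \<Rightarrow> real mat) \<Rightarrow> bool" where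
  "unconditionally_stable L T Q \<longleftrightarrow>
     (\<exists>K\<ge>0. \<exists>C\<ge>0. \<forall>m\<ge>2. \<forall>n\<ge>1. \<forall>U :: nat \<Rightarrow> real vec.
        U 0 \<in> carrier_vec (m - 1) \<and> (\<forall>j<n. U (Suc j) = Q m n *\<^sub>v U j) \<longrightarrow>
        (\<forall>j\<le>n. norm2h (L / real m) (U j)
                 \<le> K * exp (C * (real j * (T / real n))) * norm2h (L / real m) (U 0)))"

end

theory Submission
  imports
    Defs
    "HOL-Analysis.Infinite_Sum"
    "HOL-Analysis.Convex"
    "Jordan_Normal_Form.Determinant"
begin

text \<open>
  The scheme is the diagonal (3,3) Pade approximation of \<open>exp (- k S)\<close>.  It never increases the
  Euclidean norm as soon as \<open>S\<close> is accretive, that is \<open>v \<bullet> S v \<ge> 0\<close> for every real vector \<open>v\<close>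
  (\<open>S\<close> itself is in general not symmetric).  So stability holds with \<open>K = 1\<close> and \<open>C = 0\<close>, and the two things
  to show are this property of the Pade step and the accretivity of the products \<open>A M\<close>.

  For the Pade step, write numerator and denominator as \<open>E - F\<close> and \<open>E + F\<close> with even part \<open>E\<close> and odd part
  \<open>F\<close>.  Then \<open>|(E + F) v|\<^sup>2 - |(E - F) v|\<^sup>2 = 4 (E v \<bullet> F v)\<close>, and the polynomial identity
  \<open>E(x) F(y) + F(x) E(y) = (x + y) (12 (x\<^sup>2 + 10) (y\<^sup>2 + 10) + 600 x y + 6000)\<close> shows that \<open>E v \<bullet> F v\<close>
  is a positive combination of terms \<open>q \<bullet> S q\<close> (lemma \<open>pade_energy\<close>).

  For the accretivity, note that up to a positive factor \<open>M\<close> is the Toeplitz matrix of the symbol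
  \<open>(2 - 2 cos x)\<close> to the power \<open>\<nu>/2\<close>, and \<open>A\<close> is the banded Toeplitz matrix whose symbol is a
  polynomial in \<open>2 - 2 cos x\<close> with constant term 1 and nonnegative coefficients (\<open>vartheta_eq\<close>).
  On the whole line the product of the two operators is therefore bounded below by the operator of
  \<open>M\<close> (\<open>vartheta_symbol\<close>).  Cutting off to finitely many grid points destroys the product
  structure only near the two ends: the quadratic form of \<open>A M\<close> loses the terms in which \<open>A\<close> leads
  out of the grid (\<open>quadratic_form_eq\<close>).  These are controlled by the energy \<open>u \<bullet> M u\<close>,
  for two reasons.  The factorisation \<open>(2 - 2 cos x)^(\<nu>/2) = |(1 - z)^(\<nu>/2)|\<^sup>2\<close>, where
  \<open>z\<close> is a unit complex number with argument \<open>x\<close>, turns the energy into a sum of squares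
  of the fractional difference of \<open>u\<close>, and the sign pattern of the coefficients of
  \<open>(1 - z)^(\<nu>/2)\<close> bounds the square of the \<open>k\<close>-th value of \<open>u\<close> counted from an end by \<open>k\<close>
  times the energy (\<open>square_le_left\<close>); Cauchy-Schwarz bounds the squares of the values of \<open>M u\<close>,
  suitably normalised and also outside the grid, by twice the energy
  (\<open>potential_square_le\<close>).  The off-diagonal coefficients of \<open>A\<close> are so small that
  the total loss is at most the energy, for all \<open>0 < \<nu> \<le> 2\<close> and all six \<open>p\<close>
  (\<open>vartheta_small\<close>).
\<close>

unbundle no inner_syntax

section \<open>Autocorrelations and second differences\<close>

lemma has_sum_finite_sum:
  fixes f :: "'i \<Rightarrow> 'a \<Rightarrow> 'b :: topological_comm_monoid_add"
  assumes "finite I" and "\<And>i. i \<in> I \<Longrightarrow> (f i has_sum s i) A"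
  shows "((\<lambda>x. \<Sum>i\<in>I. f i x) has_sum (\<Sum>i\<in>I. s i)) A"
  using assms by (induction I rule: finite_induct) (auto intro: has_sum_add has_sum_0)

lemma has_sum_shift:
  fixes f :: "int \<Rightarrow> real"
  shows "((\<lambda>n. f (n + d)) has_sum s) UNIV \<longleftrightarrow> (f has_sum s) UNIV"
  by (rule has_sum_reindex_bij_witness[where i = "\<lambda>n. n - d" and j = "\<lambda>n. n + d"]) auto

text \<open>
  A square summable sequence enters the argument only through its autocorrelation.  Taking
  second differences of the autocorrelation corresponds to replacing the sequence by its forward
  difference, and its value at 0 is a sum of squares; this gives the positivity of polynomials in
  \<open>2 - 2 cos x\<close> with nonnegative coefficients without any Fourier analysis.
\<close>

definition autocorrelation :: "(int \<Rightarrow> real) \<Rightarrow> bool" where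
  "autocorrelation \<beta> \<longleftrightarrow> (\<exists>y. \<forall>d. ((\<lambda>n. y n * y (n + d)) has_sum \<beta> d) UNIV)"

definition second_diff :: "(int \<Rightarrow> real) \<Rightarrow> int \<Rightarrow> real" where
  "second_diff \<beta> d = 2 * \<beta> d - \<beta> (d + 1) - \<beta> (d - 1)"

lemma autocorrelation_0_nonneg: "autocorrelation \<beta> \<Longrightarrow> \<beta> 0 \<ge> 0"
proof -
  assume "autocorrelation \<beta>"
  then obtain y where "\<And>d. ((\<lambda>n. y n * y (n + d)) has_sum \<beta> d) UNIV"
    by (auto simp: autocorrelation_def)
  from this[of 0] show ?thesis by (rule has_sum_nonneg) simp
qed

text \<open>
  The second difference of the autocorrelation of \<open>y\<close> is the autocorrelation of
  \<open>y (n + 1) - y n\<close>.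
\<close>

lemma autocorrelation_second_diff:
  assumes "autocorrelation \<beta>" shows "autocorrelation (second_diff \<beta>)"
proof -
  obtain y where y: "\<And>d. ((\<lambda>n. y n * y (n + d)) has_sum \<beta> d) UNIV"
    using assms by (auto simp: autocorrelation_def)
  have y': "((\<lambda>n. y (n + 1) * y (n + 1 + d)) has_sum \<beta> d) UNIV" for d
    using y[of d] has_sum_shift[of "\<lambda>n. y n * y (n + d)" 1] by simp
  define z where "z n = y (n + 1) - y n" for n
  have "((\<lambda>n. z n * z (n + d)) has_sum second_diff \<beta> d) UNIV" for d
  proof -
    have "((\<lambda>n. (y (n + 1) * y (n + 1 + d) + y n * y (n + d)) +
            - 1 * (y n * y (n + (d + 1)) + y (n + 1) * y (n + 1 + (d - 1))))
          has_sum ((\<beta> d + \<beta> d) + - 1 * (\<beta> (d + 1) + \<beta> (d - 1)))) UNIV"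
      by (intro has_sum_add has_sum_cmult_right y y')
    moreover have "n + 1 + (d - 1) = n + d" "n + (d + 1) = n + 1 + d" "n + d + 1 = n + 1 + d" for n
      by auto
    ultimately show ?thesis
      by (simp add: z_def second_diff_def algebra_simps)
  qed
  then show ?thesis by (auto simp: autocorrelation_def)
qed

lemma autocorrelation_iterate:
  "autocorrelation \<beta> \<Longrightarrow> autocorrelation ((second_diff ^^ k) \<beta>)"
  by (induction k) (simp_all add: autocorrelation_second_diff)

text \<open>
  The symbol of \<open>second_diff\<close> is \<open>2 - z - 1/z = - (1 - z)\<^sup>2 / z\<close>, so its powers
  have the signed even rows of Pascal's triangle as coefficients.
\<close>

lemma funpow_second_diff:
  "(second_diff ^^ k) \<beta> d =
    (\<Sum>j\<le>2 * k. (- 1) ^ (k + j) * real (2 * k choose j) * \<beta> (d + int j - int k))"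
proof (induction k arbitrary: d)
  case (Suc k)
  define N where "N = 2 * k"
  define b where "b j = \<beta> (d + int j - int k - 1)" for j
  define c where "c j = (- 1) ^ (k + j) * real (N choose j)" for j
  have c0: "c j = 0" if "j > N" for j using that by (simp add: c_def binomial_eq_0)
  have IH: "(second_diff ^^ k) \<beta> e = (\<Sum>j\<le>N. c j * \<beta> (e + int j - int k))" for e
    unfolding Suc c_def N_def by simp
  \<comment> \<open>The three shifted copies are written over the common values \<open>b (j + 2)\<close>, so that Pascal's rule applies twice.\<close>
  have 0: "(second_diff ^^ k) \<beta> d = c 0 * b 1 + (\<Sum>j\<le>N. c (Suc j) * b (Suc (Suc j)))"
  proof -
    have "(second_diff ^^ k) \<beta> d = (\<Sum>j\<le>Suc N. c j * b (Suc j))"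
      unfolding IH by (simp add: b_def c0 algebra_simps)
    then show ?thesis unfolding sum.atMost_Suc_shift by simp
  qed
  have 1: "(second_diff ^^ k) \<beta> (d + 1) = (\<Sum>j\<le>N. c j * b (Suc (Suc j)))"
    unfolding IH by (simp add: b_def algebra_simps)
  have 2: "(second_diff ^^ k) \<beta> (d - 1) =
      c 0 * b 0 + c 1 * b 1 + (\<Sum>j\<le>N. c (Suc (Suc j)) * b (Suc (Suc j)))"
  proof -
    have "(second_diff ^^ k) \<beta> (d - 1) = (\<Sum>j\<le>Suc (Suc N). c j * b j)"
      unfolding IH by (simp add: b_def c0 algebra_simps)
    then show ?thesis unfolding sum.atMost_Suc_shift by simp
  qed
  have 3: "(\<Sum>j\<le>2 * Suc k. (- 1) ^ (Suc k + j) * real (2 * Suc k choose j) * \<beta> (d + int j - int (Suc k)))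
      = (2 * c 0 - c 1) * b 1 - c 0 * b 0 +
        (\<Sum>j\<le>N. (2 * c (Suc j) - c j - c (Suc (Suc j))) * b (Suc (Suc j)))"
  proof -
    have pascal: "(- 1) ^ (Suc k + Suc (Suc j)) * real (Suc (Suc N) choose Suc (Suc j)) =
        2 * c (Suc j) - c j - c (Suc (Suc j))" for j
      by (simp add: c_def binomial_Suc_Suc algebra_simps)
    have "2 * Suc k = Suc (Suc N)" by (simp add: N_def)
    moreover have "d + int j - int (Suc k) = d + int j - int k - 1" for j by simp
    ultimately have "(\<Sum>j\<le>2 * Suc k. (- 1) ^ (Suc k + j) * real (2 * Suc k choose j) * \<beta> (d + int j - int (Suc k)))
      = (\<Sum>j\<le>Suc (Suc N). (- 1) ^ (Suc k + j) * real (Suc (Suc N) choose j) * b j)"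
      by (simp only: b_def)
    also have "\<dots> = (- 1) ^ Suc k * b 0 + (- 1) ^ (Suc k + 1) * real (Suc (Suc N)) * b 1 +
        (\<Sum>j\<le>N. (- 1) ^ (Suc k + Suc (Suc j)) * real (Suc (Suc N) choose Suc (Suc j)) * b (Suc (Suc j)))"
      unfolding sum.atMost_Suc_shift by simp
    finally show ?thesis
      unfolding pascal by (simp add: c_def algebra_simps)
  qed
  have "(second_diff ^^ Suc k) \<beta> d = 2 * (second_diff ^^ k) \<beta> d -
      (second_diff ^^ k) \<beta> (d + 1) - (second_diff ^^ k) \<beta> (d - 1)"
    by (simp add: second_diff_def)
  moreover have "(\<Sum>j\<le>N. (2 * c (Suc j) - c j - c (Suc (Suc j))) * b (Suc (Suc j))) =
      2 * (\<Sum>j\<le>N. c (Suc j) * b (Suc (Suc j))) - (\<Sum>j\<le>N. c j * b (Suc (Suc j))) -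
      (\<Sum>j\<le>N. c (Suc (Suc j)) * b (Suc (Suc j)))"
    by (simp add: sum_distrib_left sum_subtractf left_diff_distrib mult.assoc)
  ultimately show ?case
    unfolding 3 0 1 2 by (simp only: left_diff_distrib) simp
qed simp

lemma iterated_second_diff:
  assumes k: "int k \<le> K"
  shows "(second_diff ^^ k) \<beta> 0 =
    (\<Sum>s\<in>{-K..K}. (- 1) ^ nat \<bar>s\<bar> * real (2 * k choose (k + nat \<bar>s\<bar>)) * \<beta> s)"
proof -
  have "(second_diff ^^ k) \<beta> 0 =
      (\<Sum>s\<in>{- int k..int k}. (- 1) ^ nat \<bar>s\<bar> * real (2 * k choose (k + nat \<bar>s\<bar>)) * \<beta> s)"
    unfolding funpow_second_diff
  proof (rule sum.reindex_bij_witness[where j = "\<lambda>j. int j - int k" and i = "\<lambda>s. nat (s + int k)"])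
    fix j assume j: "j \<in> {..2 * k}"
    have "even (k + j) = even (nat \<bar>int j - int k\<bar>)" by (simp add: even_nat_iff) presburger
    then have "(- 1 :: real) ^ (k + j) = (- 1) ^ nat \<bar>int j - int k\<bar>"
      by (simp only: minus_one_power_iff)
    moreover have "2 * k choose (k + nat \<bar>int j - int k\<bar>) = 2 * k choose j"
    proof (cases "k \<le> j")
      case True then show ?thesis by (simp add: nat_diff_distrib)
    next
      case False
      then have "k + nat \<bar>int j - int k\<bar> = 2 * k - j" by simp
      then show ?thesis using j binomial_symmetric[of j "2 * k"]
        by (simp only: atMost_iff)
    qed
    ultimately show "(- 1) ^ nat \<bar>int j - int k\<bar> * real (2 * k choose (k + nat \<bar>int j - int k\<bar>)) *
        \<beta> (int j - int k) = (- 1) ^ (k + j) * real (2 * k choose j) * \<beta> (0 + int j - int k)"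
      by simp
  qed auto
  also have "\<dots> = (\<Sum>s\<in>{-K..K}. (- 1) ^ nat \<bar>s\<bar> * real (2 * k choose (k + nat \<bar>s\<bar>)) * \<beta> s)"
    using k by (intro sum.mono_neutral_left) (auto simp: binomial_eq_0)
  finally show ?thesis .
qed

section \<open>Fractional differences and the numbers omega\<close>

text \<open>
  In the application \<open>\<mu> = \<nu>/2\<close>.
\<close>

locale fractional_difference =
  fixes \<mu> :: real
  assumes mu_pos: "0 < \<mu>" and mu_le_1: "\<mu> \<le> 1"
begin

text \<open>
  The Taylor coefficients of \<open>(1 - z)\<close> to the power \<open>\<mu>\<close>, extended by zero to negative indices.
\<close>

definition w :: "int \<Rightarrow> real" where
  "w k = (if k < 0 then 0 else (- 1) ^ nat k * (\<mu> gchoose nat k))"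

lemma w_0 [simp]: "w 0 = 1" and w_neg: "k < 0 \<Longrightarrow> w k = 0"
  by (simp_all add: w_def)

lemma w_Suc: "(real l + 1) * w (int l + 1) = (real l - \<mu>) * w (int l)"
proof -
  have "nat (int l + 1) = Suc l" by simp
  then have "(real l + 1) * w (int l + 1) = - ((- 1) ^ l * ((real l + 1) * (\<mu> gchoose Suc l)))"
    by (simp add: w_def)
  also have "(real l + 1) * (\<mu> gchoose Suc l) = (\<mu> - real l) * (\<mu> gchoose l)"
    using gbinomial_mult_1[of \<mu> l] by (simp add: algebra_simps)
  finally show ?thesis by (simp add: w_def algebra_simps)
qed

text \<open>
  This is the derivative rule for \<open>(1 - z)^\<mu>\<close>: the partial sums are the coefficients of
  \<open>(1 - z)^(\<mu> - 1)\<close>.  Together with \<open>w_nonpos\<close> it shows that the coefficients after the first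
  are nonpositive with total mass at most 1, and that they decay like \<open>1/n\<close>.
\<close>

lemma w_Suc_eq_partial_sum: "(real n + 1) * w (int n + 1) = - \<mu> * (\<Sum>l\<le>n. w (int l))"
proof (induction n)
  case 0 show ?case using w_Suc[of 0] by simp
next
  case (Suc n)
  have "(real (Suc n) + 1) * w (int (Suc n) + 1) = (real n + 1) * w (int n + 1) - \<mu> * w (int n + 1)"
    using w_Suc[of "Suc n"] by (simp add: algebra_simps)
  with Suc show ?case by (simp add: algebra_simps)
qed

lemma w_nonpos: "k > 0 \<Longrightarrow> w k \<le> 0"
proof -
  have "w (int l + 1) \<le> 0" for l
  proof (induction l)
    case 0 show ?case using w_Suc[of 0] mu_pos by simp
  next
    case (Suc l)
    have "(real (Suc l) + 1) * w (int (Suc l) + 1) = (real (Suc l) - \<mu>) * w (int l + 1)"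
      using w_Suc[of "Suc l"] by (simp add: algebra_simps)
    also have "\<dots> \<le> 0"
      using Suc mu_le_1 by (intro mult_nonneg_nonpos) auto
    finally show ?case by (simp add: mult_le_0_iff)
  qed
  from this[of "nat (k - 1)"] show "k > 0 \<Longrightarrow> w k \<le> 0" by simp
qed

lemma partial_sum_nonneg: "(\<Sum>l\<le>n. w (int l)) \<ge> 0"
proof -
  have "(real n + 1) * w (int n + 1) \<le> 0"
    using w_nonpos[of "int n + 1"] by (simp add: mult_le_0_iff)
  then have "\<mu> * (\<Sum>l\<le>n. w (int l)) \<ge> 0"
    using w_Suc_eq_partial_sum[of n] by simp
  then show ?thesis using mu_pos by (simp add: zero_le_mult_iff)
qed

lemma sum_abs_w_le_1: "(\<Sum>l=1..n. \<bar>w (int l)\<bar>) \<le> 1"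
proof -
  have "(\<Sum>l\<le>n. w (int l)) = 1 + (\<Sum>l=1..n. w (int l))"
    by (simp add: atMost_atLeast0 sum.atLeast_Suc_atMost)
  moreover have "(\<Sum>l=1..n. \<bar>w (int l)\<bar>) = - (\<Sum>l=1..n. w (int l))"
    unfolding sum_negf[symmetric] by (intro sum.cong) (auto simp: w_nonpos)
  ultimately show ?thesis using partial_sum_nonneg[of n] by linarith
qed

lemma sum_abs_w_le_2: "(\<Sum>l<n. \<bar>w (int l)\<bar>) \<le> 2"
proof -
  have "(\<Sum>l<n. \<bar>w (int l)\<bar>) \<le> (\<Sum>l\<le>n. \<bar>w (int l)\<bar>)"
    by (intro sum_mono2) auto
  also have "\<dots> = 1 + (\<Sum>l=1..n. \<bar>w (int l)\<bar>)"
    by (simp add: atMost_atLeast0 sum.atLeast_Suc_atMost)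
  finally show ?thesis using sum_abs_w_le_1[of n] by simp
qed

lemma abs_w_le_1: "\<bar>w k\<bar> \<le> 1"
proof (cases "k > 0")
  case True
  have "\<bar>w (int (nat k))\<bar> \<le> (\<Sum>l=1..nat k. \<bar>w (int l)\<bar>)"
    using True by (intro member_le_sum) auto
  with sum_abs_w_le_1[of "nat k"] True show ?thesis by simp
next
  case False
  then have "k = 0 \<or> k < 0" by auto
  then show ?thesis by (auto simp: w_neg)
qed

lemma abs_mult_w_le_1: "\<bar>real l * w (int l)\<bar> \<le> 1"
proof (cases l)
  case (Suc n)
  have "(\<Sum>l\<le>n. w (int l)) \<le> 1"
  proof -
    have "(\<Sum>l=1..n. w (int l)) \<le> 0" by (intro sum_nonpos) (auto simp: w_nonpos)
    then show ?thesis by (simp add: atMost_atLeast0 sum.atLeast_Suc_atMost)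
  qed
  then have "\<bar>\<mu> * (\<Sum>l\<le>n. w (int l))\<bar> \<le> 1 * 1"
    unfolding abs_mult using mu_pos mu_le_1 partial_sum_nonneg[of n]
    by (intro mult_mono) auto
  then show ?thesis using w_Suc_eq_partial_sum[of n] Suc by (simp add: algebra_simps)
qed simp

lemma summable_abs_w: "summable (\<lambda>l. \<bar>w (int l)\<bar>)"
  by (rule summableI_nonneg_bounded[OF _ sum_abs_w_le_2]) simp

text \<open>
  The autocorrelation of the coefficients \<open>w\<close>; \<open>omega\<close> is a positive multiple of it
  (\<open>omega_eq_g\<close>).  Leaving the constant undetermined avoids Gauss's summation theorem.
\<close>

definition g :: "int \<Rightarrow> real" where
  "g r = (\<Sum>l. w (int l) * w (int l + \<bar>r\<bar>))"

lemma g_minus [simp]: "g (- r) = g r"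
  by (simp add: g_def)

lemma summable_abs_w_mult: "summable (\<lambda>l. \<bar>w (int l) * w (int l + r)\<bar>)"
  by (rule summable_comparison_test'[OF summable_abs_w, of 0])
     (use abs_w_le_1 in \<open>auto simp: abs_mult intro!: mult_left_le\<close>)

lemma g_sums: "r \<ge> 0 \<Longrightarrow> (\<lambda>l. w (int l) * w (int l + r)) sums g r"
  using summable_rabs_cancel[OF summable_abs_w_mult[of r]] by (simp add: g_def summable_sums)

lemma has_sum_g_nonneg:
  assumes "i \<le> j"
  shows "((\<lambda>n. w (n - i) * w (n - j)) has_sum g (i - j)) UNIV"
proof -
  have "((\<lambda>l. w (int l) * w (int l + (j - i))) has_sum g (j - i)) UNIV"
    using assms by (intro norm_summable_imp_has_sum g_sums) (use summable_abs_w_mult in auto)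
  then have "((\<lambda>n. w (n - i) * w (n - j)) has_sum g (j - i)) {j..}"
    by (subst (asm) has_sum_reindex_bij_witness[where j = "\<lambda>l. j + int l" and i = "\<lambda>n. nat (n - j)"
        and T = "{j..}" and h = "\<lambda>n. w (n - i) * w (n - j)" and s' = "g (j - i)"])
       (auto simp: algebra_simps)
  then have "((\<lambda>n. w (n - i) * w (n - j)) has_sum g (j - i)) UNIV"
    by (subst (asm) has_sum_cong_neutral[where T = UNIV and g = "\<lambda>n. w (n - i) * w (n - j)"])
       (auto simp: w_neg)
  then show ?thesis using g_minus[of "j - i"] by simp
qed

lemma has_sum_g: "((\<lambda>n. w (n - i) * w (n - j)) has_sum g (i - j)) UNIV"
proof (cases "i \<le> j")
  case False
  then show ?thesis
    using has_sum_g_nonneg[of j i] g_minus[of "i - j"] by (simp add: mult.commute)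
qed (rule has_sum_g_nonneg)

lemma g_0_le_2: "g 0 \<le> 2"
proof (rule LIMSEQ_le_const2[OF g_sums[of 0, unfolded sums_def]])
  have "(\<Sum>l<n. w (int l) * w (int l + 0)) \<le> (\<Sum>l<n. \<bar>w (int l)\<bar>)" for n
  proof (intro sum_mono)
    fix l
    have "w (int l) * w (int l) \<le> \<bar>w (int l)\<bar> * 1"
      unfolding abs_mult_self_eq[symmetric, of "w (int l)"]
      by (intro mult_left_mono abs_w_le_1) auto
    then show "w (int l) * w (int l + 0) \<le> \<bar>w (int l)\<bar>" by simp
  qed
  then have "(\<Sum>l<n. w (int l) * w (int l + 0)) \<le> 2" for n
    using sum_abs_w_le_2[of n] order_trans by blast
  then show "\<exists>N. \<forall>n\<ge>N. (\<Sum>l<n. w (int l) * w (int l + 0)) \<le> 2" by blast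
qed simp

lemma g_0_ge_1: "g 0 \<ge> 1"
proof -
  have s: "(\<lambda>l. w (int l) * w (int l + 0)) sums g 0" by (rule g_sums) simp
  have "(\<Sum>l<1. w (int l) * w (int l + 0)) \<le> (\<Sum>l. w (int l) * w (int l + 0))"
    using s by (intro sum_le_suminf) (auto simp: sums_iff)
  with s show ?thesis by (simp add: sums_iff)
qed

text \<open>
  The recurrence is found by creative telescoping: the defect of the summands is the
  difference of consecutive values of \<open>l * w l * w (l + r)\<close>, which vanishes at \<open>l = 0\<close> and tends
  to 0.  The numbers \<open>omega\<close> satisfy the same recurrence by the functional equation of \<open>Gamma\<close>.
\<close>

lemma g_Suc: "(\<mu> + real r + 1) * g (int r + 1) = (real r - \<mu>) * g (int r)"
proof -
  define f where "f l = real l * w (int l) * w (int l + int r)" for l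
  have "(\<lambda>l. w (int l)) \<longlonglongrightarrow> 0"
    using summable_LIMSEQ_zero[OF summable_rabs_cancel[OF summable_abs_w]] .
  then have "(\<lambda>l. w (int (l + r))) \<longlonglongrightarrow> 0" by (rule LIMSEQ_ignore_initial_segment)
  moreover have "\<bar>f l\<bar> \<le> \<bar>w (int (l + r))\<bar>" for l
    using abs_mult_w_le_1[of l] unfolding f_def abs_mult by (auto intro!: mult_left_le_one_le)
  ultimately have "f \<longlonglongrightarrow> 0"
    by (intro Lim_null_comparison[of f "\<lambda>l. \<bar>w (int (l + r))\<bar>"])
       (auto intro!: eventuallyI tendsto_rabs_zero)
  then have "(\<lambda>l. f l - f (Suc l)) sums (f 0 - 0)" by (rule telescope_sums')
  moreover have "f l - f (Suc l) = (\<mu> + real r + 1) * (w (int l) * w (int l + (int r + 1))) -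
      (real r - \<mu>) * (w (int l) * w (int l + int r))" for l
  proof -
    have 1: "(real l + 1) * w (int l + 1) = (real l - \<mu>) * w (int l)" by (rule w_Suc)
    have 2: "(real l + real r + 1) * w (int l + (int r + 1)) = (real l + real r - \<mu>) * w (int l + int r)"
      using w_Suc[of "l + r"] by (simp add: algebra_simps)
    have "f (Suc l) = (real l + 1) * w (int l + 1) * w (int l + (int r + 1))"
      by (simp add: f_def algebra_simps)
    then have "f (Suc l) = (real l - \<mu>) * w (int l) * w (int l + (int r + 1))"
      by (simp only: 1)
    then have "f l - f (Suc l) - ((\<mu> + real r + 1) * (w (int l) * w (int l + (int r + 1))) -
      (real r - \<mu>) * (w (int l) * w (int l + int r))) =
      w (int l) * ((real l + real r - \<mu>) * w (int l + int r) - (real l + real r + 1) * w (int l + (int r + 1)))"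
      by (simp add: f_def algebra_simps)
    with 2 show ?thesis by simp
  qed
  ultimately have "(\<lambda>l. (\<mu> + real r + 1) * (w (int l) * w (int l + (int r + 1))) -
      (real r - \<mu>) * (w (int l) * w (int l + int r))) sums 0"
    by (simp add: f_def)
  moreover have "(\<lambda>l. (\<mu> + real r + 1) * (w (int l) * w (int l + (int r + 1))) -
      (real r - \<mu>) * (w (int l) * w (int l + int r))) sums
      ((\<mu> + real r + 1) * g (int r + 1) - (real r - \<mu>) * g (int r))"
    by (intro sums_diff sums_mult g_sums) auto
  ultimately show ?thesis using sums_unique2 by fastforce
qed

lemma omega_Suc:
  "(\<mu> + real r + 1) * omega (2 * \<mu>) (int r + 1) = (real r - \<mu>) * omega (2 * \<mu>) (int r)"
proof -
  have 1: "(\<mu> - real r) * rGamma (\<mu> - real r + 1) = rGamma (\<mu> - real r)"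
    by (rule rGamma_plus1)
  have 2: "(\<mu> + real r + 1) * rGamma (\<mu> + real r + 1 + 1) = rGamma (\<mu> + real r + 1)"
    by (rule rGamma_plus1)
  define X where "X = rGamma (\<mu> - real r + 1)"
  define Y where "Y = rGamma (\<mu> + real r + 1 + 1)"
  have "omega (2 * \<mu>) (int r + 1) =
      - ((- 1) ^ r * Gamma (2 * \<mu> + 1) * rGamma (\<mu> - real r) * rGamma (\<mu> + real r + 1 + 1))"
    by (simp add: omega_def power_int_add algebra_simps)
  moreover have "omega (2 * \<mu>) (int r) =
      (- 1) ^ r * Gamma (2 * \<mu> + 1) * rGamma (\<mu> - real r + 1) * rGamma (\<mu> + real r + 1)"
    by (simp add: omega_def)
  ultimately show ?thesis
    unfolding 1[symmetric] 2[symmetric] X_def[symmetric] Y_def[symmetric]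
    by (simp only:) (simp add: algebra_simps)
qed

lemma omega_0_pos: "omega (2 * \<mu>) 0 > 0"
proof -
  have "rGamma (\<mu> + 1) > 0" "Gamma (2 * \<mu> + 1) > 0"
    using mu_pos by (auto simp: rGamma_inverse_Gamma intro!: Gamma_real_pos)
  then show ?thesis by (simp add: omega_def)
qed

lemma omega_eq_g: "omega (2 * \<mu>) \<bar>r\<bar> = omega (2 * \<mu>) 0 / g 0 * g r"
proof -
  have "omega (2 * \<mu>) (int n) = omega (2 * \<mu>) 0 / g 0 * g (int n)" for n
  proof (induction n)
    case 0 show ?case using g_0_ge_1 by simp
  next
    case (Suc n)
    have nz: "\<mu> + real n + 1 > 0" using mu_pos by simp
    have "(\<mu> + real n + 1) * omega (2 * \<mu>) (int n + 1) =
        omega (2 * \<mu>) 0 / g 0 * ((\<mu> + real n + 1) * g (int n + 1))"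
      unfolding omega_Suc g_Suc Suc by simp
    then have "(\<mu> + real n + 1) * omega (2 * \<mu>) (int n + 1) =
        (\<mu> + real n + 1) * (omega (2 * \<mu>) 0 / g 0 * g (int n + 1))" by (simp only: mult_ac)
    then have "omega (2 * \<mu>) (int n + 1) = omega (2 * \<mu>) 0 / g 0 * g (int n + 1)"
      using nz by (subst (asm) mult_left_cancel) auto
    then show ?case by (simp add: add.commute)
  qed
  from this[of "nat \<bar>r\<bar>"] show ?thesis by (simp add: g_def)
qed

section \<open>The quadratic form of a banded Toeplitz matrix times the fractional difference matrix\<close>

text \<open>
  A grid function is a function \<open>u\<close> on the integers that vanishes outside \<open>{0..<N}\<close>.
  \<open>filtered\<close> applies the fractional difference \<open>(1 - z)^\<mu>\<close> to it, and \<open>potential\<close> applies the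
  operator with kernel \<open>g\<close>, that is the normalised matrix \<open>M\<close>, also at points outside the grid.
\<close>

definition filtered :: "nat \<Rightarrow> (int \<Rightarrow> real) \<Rightarrow> int \<Rightarrow> real" where
  "filtered N u n = (\<Sum>i\<in>{0..<int N}. w (n - i) * u i)"

definition potential :: "nat \<Rightarrow> (int \<Rightarrow> real) \<Rightarrow> int \<Rightarrow> real" where
  "potential N u i = (\<Sum>j\<in>{0..<int N}. g (i - j) * u j)"

text \<open>
  The autocorrelation of \<open>filtered N u\<close>; its value at 0 is the energy of \<open>u\<close>.  Both
  descriptions are needed: the finite sum below is what the matrices produce, the infinite sum of
  \<open>has_sum_correlation\<close> is what makes it positive.
\<close>

definition correlation :: "nat \<Rightarrow> (int \<Rightarrow> real) \<Rightarrow> int \<Rightarrow> real" where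
  "correlation N u d = (\<Sum>j\<in>{0..<int N}. u j * potential N u (j + d))"

lemma has_sum_potential:
  "((\<lambda>n. w (n - i) * filtered N u n) has_sum potential N u i) UNIV"
proof -
  have "((\<lambda>n. \<Sum>j\<in>{0..<int N}. w (n - i) * w (n - j) * u j) has_sum potential N u i) UNIV"
    unfolding potential_def by (intro has_sum_finite_sum has_sum_cmult_left has_sum_g) auto
  then show ?thesis by (simp add: filtered_def sum_distrib_left mult.assoc)
qed

lemma has_sum_correlation:
  "((\<lambda>n. filtered N u n * filtered N u (n + d)) has_sum correlation N u d) UNIV"
proof -
  have "((\<lambda>n. \<Sum>j\<in>{0..<int N}. u j * (w (n - (j + d)) * filtered N u n)) has_sum correlation N u d) UNIV"
    unfolding correlation_def by (intro has_sum_finite_sum has_sum_cmult_right has_sum_potential) auto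
  moreover have "(\<Sum>j\<in>{0..<int N}. u j * (w (n - (j + d)) * filtered N u n)) =
      filtered N u (n - d) * filtered N u n" for n
    unfolding filtered_def[of _ _ "n - d"] sum_distrib_right by (simp add: algebra_simps)
  ultimately have "((\<lambda>n. filtered N u (n - d) * filtered N u n) has_sum correlation N u d) UNIV"
    by simp
  then show ?thesis
    using has_sum_shift[of "\<lambda>n. filtered N u (n - d) * filtered N u n" d] by simp
qed

lemma autocorrelation_correlation: "autocorrelation (correlation N u)"
  using has_sum_correlation unfolding autocorrelation_def by blast

lemmas energy_nonneg = autocorrelation_0_nonneg[OF autocorrelation_correlation]

text \<open>
  Cauchy-Schwarz for \<open>filtered N u\<close> and the translate of \<open>w\<close> by \<open>i\<close>, whose square sum is
  \<open>g 0 \<le> 2\<close>.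
\<close>

lemma potential_square_le: "(potential N u i)\<^sup>2 \<le> 2 * correlation N u 0"
proof -
  \<comment> \<open>The parameter of the nonnegative square that is optimal if the square sum equals 2.\<close>
  define t where "t = potential N u i / 2"
  have "((\<lambda>n. filtered N u n * filtered N u (n + 0) + (- 2 * t * (w (n - i) * filtered N u n)
      + t\<^sup>2 * (w (n - i) * w (n - i)))) has_sum
      (correlation N u 0 + (- 2 * t * potential N u i + t\<^sup>2 * g (i - i)))) UNIV"
    by (intro has_sum_add has_sum_cmult_right has_sum_correlation has_sum_potential has_sum_g)
  moreover have "filtered N u n * filtered N u (n + 0) + (- 2 * t * (w (n - i) * filtered N u n)
      + t\<^sup>2 * (w (n - i) * w (n - i))) = (filtered N u n - t * w (n - i))\<^sup>2" for n
    by (simp add: power2_eq_square algebra_simps)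
  ultimately have "((\<lambda>n. (filtered N u n - t * w (n - i))\<^sup>2) has_sum
      (correlation N u 0 + (- 2 * t * potential N u i + t\<^sup>2 * g (i - i)))) UNIV" by simp
  then have "0 \<le> correlation N u 0 + (- 2 * t * potential N u i + t\<^sup>2 * g 0)"
    using has_sum_nonneg by fastforce
  moreover have "t\<^sup>2 * g 0 \<le> t\<^sup>2 * 2" by (intro mult_left_mono g_0_le_2) auto
  moreover have "2 * t * potential N u i = (potential N u i)\<^sup>2" "t\<^sup>2 * 2 = (potential N u i)\<^sup>2 / 2"
    by (simp_all add: t_def power2_eq_square)
  ultimately show ?thesis by linarith
qed

text \<open>
  Inverting the fractional difference from the left end: \<open>u k\<close> is the filtered value minus a
  combination of earlier values of \<open>u\<close> whose coefficients have absolute sum at most 1, so the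
  maximum of \<open>|u|\<close> grows by at most the filtered value in each step.
\<close>

lemma abs_le_sum_filtered:
  assumes "\<And>i. i \<notin> {0..<int N} \<Longrightarrow> u i = 0"
  shows "\<bar>u (int k)\<bar> \<le> (\<Sum>l\<le>k. \<bar>filtered N u (int l)\<bar>)"
proof (induction k rule: less_induct)
  case (less k)
  define Y where "Y = (\<Sum>l<k. \<bar>filtered N u (int l)\<bar>)"
  have u_le: "\<bar>u (int j)\<bar> \<le> Y" if "j < k" for j
  proof -
    have "(\<Sum>l\<le>j. \<bar>filtered N u (int l)\<bar>) \<le> Y"
      unfolding Y_def using that by (intro sum_mono2) auto
    with less[OF that] show ?thesis by simp
  qed
  have "filtered N u (int k) = (\<Sum>i\<in>{0..int k}. w (int k - i) * u i)"
    unfolding filtered_def using assms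
    by (intro sum.mono_neutral_cong) (auto simp: w_neg)
  also have "\<dots> = (\<Sum>l=0..k. w (int l) * u (int (k - l)))"
    by (rule sum.reindex_bij_witness[where j = "\<lambda>i. nat (int k - i)" and i = "\<lambda>l. int k - int l"]) auto
  also have "\<dots> = u (int k) + (\<Sum>l=1..k. w (int l) * u (int (k - l)))"
    by (simp add: sum.atLeast_Suc_atMost)
  finally have "u (int k) = filtered N u (int k) - (\<Sum>l=1..k. w (int l) * u (int (k - l)))" by simp
  moreover have "\<bar>\<Sum>l=1..k. w (int l) * u (int (k - l))\<bar> \<le> Y"
  proof -
    have "\<bar>\<Sum>l=1..k. w (int l) * u (int (k - l))\<bar> \<le> (\<Sum>l=1..k. \<bar>w (int l)\<bar> * Y)"
    proof (rule order_trans[OF sum_abs], rule sum_mono)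
      fix l assume "l \<in> {1..k}"
      then show "\<bar>w (int l) * u (int (k - l))\<bar> \<le> \<bar>w (int l)\<bar> * Y"
        unfolding abs_mult by (intro mult_left_mono u_le) auto
    qed
    also have "\<dots> \<le> 1 * Y"
      unfolding sum_distrib_right[symmetric]
      by (intro mult_right_mono sum_abs_w_le_1) (simp add: Y_def sum_nonneg)
    finally show ?thesis by simp
  qed
  ultimately have "\<bar>u (int k)\<bar> \<le> \<bar>filtered N u (int k)\<bar> + Y" by linarith
  then show ?case by (simp add: Y_def lessThan_Suc_atMost[symmetric])
qed

lemma square_le_left:
  assumes "\<And>i. i \<notin> {0..<int N} \<Longrightarrow> u i = 0"
  shows "(u (int k))\<^sup>2 \<le> (real k + 1) * correlation N u 0"
proof -
  have "(u (int k))\<^sup>2 \<le> (\<Sum>l\<le>k. \<bar>filtered N u (int l)\<bar>)\<^sup>2"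
    using abs_le_sum_filtered[of N u k, OF assms] by (simp add: abs_le_square_iff[symmetric] sum_nonneg)
  also have "\<dots> \<le> (real k + 1) * (\<Sum>l\<le>k. \<bar>filtered N u (int l)\<bar>\<^sup>2)"
    using sum_squared_le_sum_of_squares[of "\<lambda>l. \<bar>filtered N u (int l)\<bar>" "{..k}"]
    by (simp add: mult.commute add.commute)
  also have "(\<Sum>l\<le>k. \<bar>filtered N u (int l)\<bar>\<^sup>2) \<le> correlation N u 0"
  proof -
    have "(\<Sum>l\<le>k. \<bar>filtered N u (int l)\<bar>\<^sup>2) = (\<Sum>n\<in>int ` {..k}. filtered N u n * filtered N u (n + 0))"
      by (subst sum.reindex) (auto simp: power2_eq_square)
    also have "\<dots> \<le> correlation N u 0"
      by (rule has_sum_mono_neutral[OF has_sum_finite has_sum_correlation]) auto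
    finally show ?thesis .
  qed
  finally show ?thesis by (simp add: mult_left_mono)
qed

definition reflect :: "nat \<Rightarrow> (int \<Rightarrow> real) \<Rightarrow> int \<Rightarrow> real" where
  "reflect N u i = u (int N - 1 - i)"

text \<open>
  The kernel is even, so the estimate at the left end transfers to the right end by
  reflection.
\<close>

lemma potential_reflect: "potential N (reflect N u) i = potential N u (int N - 1 - i)"
  unfolding potential_def reflect_def
proof (rule sum.reindex_bij_witness[where i = "\<lambda>j. int N - 1 - j" and j = "\<lambda>j. int N - 1 - j"])
  fix j
  have "g (int N - 1 - i - (int N - 1 - j)) = g (- (i - j))" by simp
  also have "\<dots> = g (i - j)" by (rule g_minus)
  finally show "g (int N - 1 - i - (int N - 1 - j)) * u (int N - 1 - j) = g (i - j) * u (int N - 1 - j)"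
    by simp
qed auto

lemma energy_reflect: "correlation N (reflect N u) 0 = correlation N u 0"
  unfolding correlation_def potential_reflect
  by (rule sum.reindex_bij_witness[where i = "\<lambda>j. int N - 1 - j" and j = "\<lambda>j. int N - 1 - j"])
     (auto simp: reflect_def)

text \<open>
  The part of \<open>correlation N u s\<close> that comes from points of the grid which the shift by \<open>s\<close> moves
  out of it.
\<close>

definition overhang :: "nat \<Rightarrow> (int \<Rightarrow> real) \<Rightarrow> int \<Rightarrow> real" where
  "overhang N u s = (\<Sum>j\<in>{j\<in>{0..<int N}. j + s \<notin> {0..<int N}}. u j * potential N u (j + s))"

text \<open>
  Only the first \<open>t\<close> points are moved out.  At the point \<open>k\<close> the arithmetic-geometric mean
  inequality gives the factor \<open>((k + 1) + 2) / 2\<close>; summing over \<open>k < t\<close> gives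
  \<open>t * (t + 5) / 4\<close>.
\<close>

lemma overhang_left:
  assumes "\<And>i. i \<notin> {0..<int N} \<Longrightarrow> u i = 0"
  shows "\<bar>overhang N u (- int t)\<bar> \<le> real t * (real t + 5) / 4 * correlation N u 0"
proof -
  have "\<bar>overhang N u (- int t)\<bar> \<le>
      (\<Sum>j\<in>{j\<in>{0..<int N}. j + - int t \<notin> {0..<int N}}. \<bar>u j * potential N u (j + - int t)\<bar>)"
    unfolding overhang_def by (rule sum_abs)
  also have "\<dots> \<le> (\<Sum>j\<in>int ` {..<t}. \<bar>u j * potential N u (j + - int t)\<bar>)"
  proof (rule sum_mono2)
    show "{j\<in>{0..<int N}. j + - int t \<notin> {0..<int N}} \<subseteq> int ` {..<t}"
    proof
      fix j assume "j \<in> {j\<in>{0..<int N}. j + - int t \<notin> {0..<int N}}"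
      then have "j = int (nat j)" "nat j < t" by auto
      then show "j \<in> int ` {..<t}" by blast
    qed
  qed auto
  also have "\<dots> = (\<Sum>k<t. \<bar>u (int k) * potential N u (int k + - int t)\<bar>)"
    by (subst sum.reindex) auto
  also have "\<dots> \<le> (\<Sum>k<t. (real k + 3) / 2 * correlation N u 0)"
  proof (rule sum_mono)
    fix k
    have "\<bar>a * b\<bar> \<le> (a\<^sup>2 + b\<^sup>2) / 2" for a b :: real
      using sum_squares_bound[of "\<bar>a\<bar>" "\<bar>b\<bar>"] by (simp add: abs_mult)
    then have "\<bar>u (int k) * potential N u (int k + - int t)\<bar>
        \<le> ((u (int k))\<^sup>2 + (potential N u (int k + - int t))\<^sup>2) / 2" .
    also have "\<dots> \<le> ((real k + 1) * correlation N u 0 + 2 * correlation N u 0) / 2"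
      by (intro divide_right_mono add_mono square_le_left[OF assms] potential_square_le) auto
    finally show "\<bar>u (int k) * potential N u (int k + - int t)\<bar> \<le> (real k + 3) / 2 * correlation N u 0"
      by (simp add: algebra_simps)
  qed
  also have "\<dots> = real t * (real t + 5) / 4 * correlation N u 0"
    by (induction t) (auto simp: field_simps)
  finally show ?thesis .
qed

lemma overhang_right_eq: "overhang N u (int t) = overhang N (reflect N u) (- int t)"
  unfolding overhang_def potential_reflect
  by (rule sum.reindex_bij_witness[where i = "\<lambda>j. int N - 1 - j" and j = "\<lambda>j. int N - 1 - j"])
     (auto simp: reflect_def algebra_simps)

lemma overhang_bound:
  assumes "\<And>i. i \<notin> {0..<int N} \<Longrightarrow> u i = 0"
  shows "\<bar>overhang N u s\<bar> \<le> real_of_int \<bar>s\<bar> * (real_of_int \<bar>s\<bar> + 5) / 4 * correlation N u 0"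
proof (cases "s \<le> 0")
  case True
  then show ?thesis using overhang_left[of N u "nat (- s)", OF assms] by simp
next
  case False
  have "\<bar>overhang N (reflect N u) (- int (nat s))\<bar> \<le>
      real (nat s) * (real (nat s) + 5) / 4 * correlation N (reflect N u) 0"
    by (rule overhang_left) (auto simp: reflect_def assms)
  then show ?thesis
    using False overhang_right_eq[of N u "nat s"] by (simp add: energy_reflect)
qed

text \<open>
  Collecting the terms of the quadratic form along the diagonals of the banded matrix: without
  the cut-off, the diagonal \<open>s\<close> would contribute the full correlation.
\<close>

lemma quadratic_form_eq:
  fixes \<theta> :: "int \<Rightarrow> real"
  assumes "\<And>s. \<bar>s\<bar> > K \<Longrightarrow> \<theta> s = 0"
  shows "(\<Sum>i\<in>{0..<int N}. (\<Sum>j\<in>{0..<int N}. \<theta> (i - j) * u j) * potential N u i) =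
    (\<Sum>s\<in>{-K..K}. \<theta> s * (correlation N u s - overhang N u s))"
proof -
  let ?I = "{0..<int N}"
  have inner: "(\<Sum>i\<in>?I. \<theta> (i - j) * potential N u i) =
      (\<Sum>s\<in>{-K..K}. if j + s \<in> ?I then \<theta> s * potential N u (j + s) else 0)" for j
  proof -
    have "(\<Sum>i\<in>?I. \<theta> (i - j) * potential N u i) =
        (\<Sum>i\<in>{i\<in>?I. \<bar>i - j\<bar> \<le> K}. \<theta> (i - j) * potential N u i)"
      using assms[of "_ - j"] by (intro sum.mono_neutral_right) (auto simp: not_le[symmetric])
    also have "\<dots> = (\<Sum>s\<in>{s\<in>{-K..K}. j + s \<in> ?I}. \<theta> s * potential N u (j + s))"
      by (rule sum.reindex_bij_witness[where j = "\<lambda>i. i - j" and i = "\<lambda>s. j + s"]) auto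
    also have "\<dots> = (\<Sum>s\<in>{-K..K}. if j + s \<in> ?I then \<theta> s * potential N u (j + s) else 0)"
      by (rule sum.inter_filter) simp
    finally show ?thesis .
  qed
  have outer: "(\<Sum>j\<in>?I. if j + s \<in> ?I then u j * potential N u (j + s) else 0) =
      correlation N u s - overhang N u s" for s
  proof -
    have "correlation N u s = (\<Sum>j\<in>?I. (if j + s \<in> ?I then u j * potential N u (j + s) else 0) +
        (if j + s \<notin> ?I then u j * potential N u (j + s) else 0))"
      unfolding correlation_def by (intro sum.cong) auto
    also have "\<dots> = (\<Sum>j\<in>?I. if j + s \<in> ?I then u j * potential N u (j + s) else 0) + overhang N u s"
      unfolding sum.distrib overhang_def by (subst sum.inter_filter) auto
    finally show ?thesis by simp
  qed
  have "(\<Sum>i\<in>?I. (\<Sum>j\<in>?I. \<theta> (i - j) * u j) * potential N u i) =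
      (\<Sum>i\<in>?I. \<Sum>j\<in>?I. u j * (\<theta> (i - j) * potential N u i))"
    unfolding sum_distrib_right by (intro sum.cong) auto
  also have "\<dots> = (\<Sum>j\<in>?I. u j * (\<Sum>i\<in>?I. \<theta> (i - j) * potential N u i))"
    by (subst sum.swap) (simp add: sum_distrib_left)
  also have "\<dots> = (\<Sum>j\<in>?I. \<Sum>s\<in>{-K..K}. \<theta> s * (if j + s \<in> ?I then u j * potential N u (j + s) else 0))"
    unfolding inner sum_distrib_left by (intro sum.cong) auto
  also have "\<dots> = (\<Sum>s\<in>{-K..K}. \<theta> s * (\<Sum>j\<in>?I. if j + s \<in> ?I then u j * potential N u (j + s) else 0))"
    by (subst sum.swap) (simp only: sum_distrib_left)
  finally show ?thesis unfolding outer .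
qed

lemma quadratic_form_nonneg:
  fixes \<theta> :: "int \<Rightarrow> real"
  assumes supp: "\<And>i. i \<notin> {0..<int N} \<Longrightarrow> u i = 0"
    and band: "\<And>s. \<bar>s\<bar> > K \<Longrightarrow> \<theta> s = 0"
    and symbol: "(\<Sum>s\<in>{-K..K}. \<theta> s * correlation N u s) \<ge> correlation N u 0"
    and small: "(\<Sum>s\<in>{-K..K}. \<bar>\<theta> s\<bar> * (real_of_int \<bar>s\<bar> * (real_of_int \<bar>s\<bar> + 5) / 4)) \<le> 1"
  shows "(\<Sum>i\<in>{0..<int N}. (\<Sum>j\<in>{0..<int N}. \<theta> (i - j) * u j) * potential N u i) \<ge> 0"
proof -
  have "(\<Sum>s\<in>{-K..K}. \<theta> s * overhang N u s) \<le>
      (\<Sum>s\<in>{-K..K}. \<bar>\<theta> s\<bar> * (real_of_int \<bar>s\<bar> * (real_of_int \<bar>s\<bar> + 5) / 4) * correlation N u 0)"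
  proof (rule sum_mono)
    fix s
    have "\<theta> s * overhang N u s \<le> \<bar>\<theta> s\<bar> * \<bar>overhang N u s\<bar>"
      unfolding abs_mult[symmetric] by simp
    also have "\<dots> \<le> \<bar>\<theta> s\<bar> * (real_of_int \<bar>s\<bar> * (real_of_int \<bar>s\<bar> + 5) / 4 * correlation N u 0)"
      by (intro mult_left_mono overhang_bound supp) auto
    finally show "\<theta> s * overhang N u s \<le>
        \<bar>\<theta> s\<bar> * (real_of_int \<bar>s\<bar> * (real_of_int \<bar>s\<bar> + 5) / 4) * correlation N u 0"
      by (simp add: mult.assoc)
  qed
  also have "\<dots> \<le> 1 * correlation N u 0"
    unfolding sum_distrib_right[symmetric] by (intro mult_right_mono small energy_nonneg)
  finally show ?thesis
    using symbol quadratic_form_eq[where K = K and \<theta> = \<theta> and N = N and u = u, OF band]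
    by (simp add: right_diff_distrib sum_subtractf)
qed

end

section \<open>The coefficients vartheta\<close>

text \<open>
  The first Taylor coefficients, in powers of \<open>s = 2 - 2 cos x\<close>, of the function
  \<open>(arcsin t / t)^\<nu>\<close> with \<open>t = sqrt s / 2\<close>; this function corrects the symbol \<open>s^(\<nu>/2)\<close> to
  \<open>|x|^\<nu>\<close>.
  They do not depend on \<open>p\<close>; the order \<open>p\<close> only decides how many of them are used.
\<close>

definition symbol_coeff :: "real \<Rightarrow> nat \<Rightarrow> real" where
  "symbol_coeff \<nu> k =
    [1,
     \<nu> * (1 / 24),
     \<nu> * (\<nu> / 1152 + 11 / 2880),
     \<nu> * (\<nu>^2 / 82944 + 11 * \<nu> / 69120 + 191 / 362880),
     \<nu> * (\<nu>^3 / 7962624 + 11 * \<nu>^2 / 3317760 + 10181 * \<nu> / 348364800 + 2497 / 29030400),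
     \<nu> * (\<nu>^4 / 955514880 + 11 * \<nu>^3 / 238878720 + 6361 * \<nu>^2 / 8360755200
        + 11693 * \<nu> / 2090188800 + 14797 / 958003200)] ! k"

lemma symbol_coeff_nonneg: "0 \<le> \<nu> \<Longrightarrow> k < 6 \<Longrightarrow> 0 \<le> symbol_coeff \<nu> k"
proof -
  assume "0 \<le> \<nu>" "k < 6"
  then have "k \<in> {0, 1, 2, 3, 4, 5}" by auto
  then show ?thesis using \<open>0 \<le> \<nu>\<close>
    by (elim insertE emptyE) (auto simp: symbol_coeff_def intro!: mult_nonneg_nonneg add_nonneg_nonneg)
qed

lemma symbol_coeff_mono:
  assumes "0 \<le> \<nu>" "\<nu> \<le> \<nu>'" "k < 6" shows "symbol_coeff \<nu> k \<le> symbol_coeff \<nu>' k"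
proof -
  have pow: "\<nu> ^ j \<le> \<nu>' ^ j" for j using assms by (intro power_mono) auto
  have "k \<in> {0, 1, 2, 3, 4, 5}" using assms by auto
  then show ?thesis using assms(1,2)
    by (elim insertE emptyE)
       (auto simp: symbol_coeff_def
         intro!: mult_mono add_mono add_nonneg_nonneg divide_right_mono mult_left_mono pow)
qed

lemma length_vartheta_list: "p \<in> {2, 4, 6, 8, 10, 12} \<Longrightarrow> length (vartheta_list p \<nu>) = p div 2"
  by (auto simp: vartheta_list_def)

lemma sum_lessThan_6: "sum f {..<6::nat} = f 0 + f 1 + f 2 + f 3 + f 4 + (f 5 :: real)"
  by (simp add: eval_nat_numeral)

lemma binomial_table:
  "4 choose 2 = (6::nat)" "4 choose 3 = (4::nat)"
  "6 choose 3 = (20::nat)" "6 choose 4 = (15::nat)" "6 choose 5 = (6::nat)"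
  "8 choose 4 = (70::nat)" "8 choose 5 = (56::nat)" "8 choose 6 = (28::nat)" "8 choose 7 = (8::nat)"
  "10 choose 5 = (252::nat)" "10 choose 6 = (210::nat)" "10 choose 7 = (120::nat)"
  "10 choose 8 = (45::nat)" "10 choose 9 = (10::nat)"
  by (simp_all add: binomial_fact' fact_numeral)

lemma sum_central_binomials:
  fixes f :: "nat \<Rightarrow> real"
  shows "(\<Sum>k<6. f k * real (2 * k choose (k + 0))) = f 0 + 2 * f 1 + 6 * f 2 + 20 * f 3 + 70 * f 4 + 252 * f 5"
    and "(\<Sum>k<6. f k * real (2 * k choose (k + 1))) = f 1 + 4 * f 2 + 15 * f 3 + 56 * f 4 + 210 * f 5"
    and "(\<Sum>k<6. f k * real (2 * k choose (k + 2))) = f 2 + 6 * f 3 + 28 * f 4 + 120 * f 5"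
    and "(\<Sum>k<6. f k * real (2 * k choose (k + 3))) = f 3 + 8 * f 4 + 45 * f 5"
    and "(\<Sum>k<6. f k * real (2 * k choose (k + 4))) = f 4 + 10 * f 5"
    and "(\<Sum>k<6. f k * real (2 * k choose (k + 5))) = f 5"
  by (simp_all add: sum_lessThan_6 binomial_table binomial_eq_0 flip: numeral_2_eq_2)

lemma vartheta_list_nth:
  assumes p: "p \<in> {2, 4, 6, 8, 10, 12}" and n: "n < p div 2"
  shows "vartheta_list p \<nu> ! n = (- 1) ^ n *
    (\<Sum>k<6. (if k < p div 2 then symbol_coeff \<nu> k else 0) * real (2 * k choose (k + n)))"
proof -
  note normalise = power_numeral_reduce distrib_left distrib_right left_diff_distrib
    right_diff_distrib mult_ac
  have "n < 6" using n p by auto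
  then consider "n = 0" | "n = 1" | "n = 2" | "n = 3" | "n = 4" | "n = 5" by linarith
  then show ?thesis
  proof cases
    case 1
    show ?thesis using p n unfolding 1 sum_central_binomials
      by (elim insertE emptyE) (simp_all add: vartheta_list_def symbol_coeff_def normalise)
  next
    case 2
    show ?thesis using p n unfolding 2 sum_central_binomials
      by (elim insertE emptyE) (simp_all add: vartheta_list_def symbol_coeff_def normalise)
  next
    case 3
    show ?thesis using p n unfolding 3 sum_central_binomials
      by (elim insertE emptyE) (simp_all add: vartheta_list_def symbol_coeff_def normalise)
  next
    case 4
    show ?thesis using p n unfolding 4 sum_central_binomials
      by (elim insertE emptyE) (simp_all add: vartheta_list_def symbol_coeff_def normalise)
  next
    case 5
    show ?thesis using p n unfolding 5 sum_central_binomials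
      by (elim insertE emptyE) (simp_all add: vartheta_list_def symbol_coeff_def normalise)
  next
    case 6
    show ?thesis using p n unfolding 6 sum_central_binomials
      by (elim insertE emptyE) (simp_all add: vartheta_list_def symbol_coeff_def normalise)
  qed
qed

text \<open>
  The list for \<open>p\<close> is the truncation of one Taylor series after \<open>p div 2\<close> terms, rewritten from
  powers of \<open>2 - z - 1/z\<close> into powers of \<open>z\<close>.  In this form all \<open>p\<close> can be treated alike, and the
  nonnegativity of the coefficients becomes visible.
\<close>

lemma vartheta_eq:
  assumes p: "p \<in> {2, 4, 6, 8, 10, 12}"
  shows "vartheta \<nu> p s = (- 1) ^ nat \<bar>s\<bar> *
    (\<Sum>k<p div 2. symbol_coeff \<nu> k * real (2 * k choose (k + nat \<bar>s\<bar>)))"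
proof (cases "nat \<bar>s\<bar> < p div 2")
  case False
  then show ?thesis using p
    by (auto simp: vartheta_def Let_def length_vartheta_list binomial_eq_0)
next
  case True
  have v: "vartheta \<nu> p s = vartheta_list p \<nu> ! nat \<bar>s\<bar>"
    using True by (simp add: vartheta_def length_vartheta_list[OF p])
  define n where "n = nat \<bar>s\<bar>"
  have "(\<Sum>k<p div 2. symbol_coeff \<nu> k * real (2 * k choose (k + n))) =
      (\<Sum>k<6. (if k < p div 2 then symbol_coeff \<nu> k else 0) * real (2 * k choose (k + n)))"
    using p by (intro sum.mono_neutral_cong_left) auto
  then show ?thesis
    using vartheta_list_nth[OF p True] unfolding v n_def by simp
qed

text \<open>
  All terms after the constant one are nonnegative multiples of values at 0 of
  autocorrelations.
\<close>

lemma vartheta_symbol: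
  assumes p: "p \<in> {2, 4, 6, 8, 10, 12}" and nu: "0 \<le> \<nu>" and \<beta>: "autocorrelation \<beta>"
  shows "\<beta> 0 \<le> (\<Sum>s\<in>{-5..5}. vartheta \<nu> p s * \<beta> s)"
proof -
  have p6: "p div 2 \<le> 6" "0 < p div 2" using p by auto
  have "(\<Sum>s\<in>{-5..5}. vartheta \<nu> p s * \<beta> s) = (\<Sum>s\<in>{-5..5}. \<Sum>k<p div 2.
      symbol_coeff \<nu> k * ((- 1) ^ nat \<bar>s\<bar> * real (2 * k choose (k + nat \<bar>s\<bar>)) * \<beta> s))"
    unfolding vartheta_eq[OF p] sum_distrib_left sum_distrib_right by (intro sum.cong) auto
  also have "\<dots> = (\<Sum>k<p div 2. symbol_coeff \<nu> k * (second_diff ^^ k) \<beta> 0)"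
  proof (subst sum.swap, rule sum.cong[OF refl])
    fix k assume "k \<in> {..<p div 2}"
    then have "int k \<le> 5" using p6 by auto
    then show "(\<Sum>s\<in>{-5..5}. symbol_coeff \<nu> k *
        ((- 1) ^ nat \<bar>s\<bar> * real (2 * k choose (k + nat \<bar>s\<bar>)) * \<beta> s)) =
        symbol_coeff \<nu> k * (second_diff ^^ k) \<beta> 0"
      by (simp only: iterated_second_diff sum_distrib_left)
  qed
  also have "\<dots> \<ge> (\<Sum>k<1. symbol_coeff \<nu> k * (second_diff ^^ k) \<beta> 0)"
    using p6 nu by (intro sum_mono2 mult_nonneg_nonneg[OF symbol_coeff_nonneg
        autocorrelation_0_nonneg[OF autocorrelation_iterate[OF \<beta>]]]) auto
  finally show ?thesis by (simp add: symbol_coeff_def)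
qed

text \<open>
  The left-hand side is largest for \<open>p = 12\<close> and \<open>\<nu> = 2\<close>, where it is about 0.923.
\<close>

lemma vartheta_small:
  assumes p: "p \<in> {2, 4, 6, 8, 10, 12}" and nu: "0 \<le> \<nu>" "\<nu> \<le> 2"
  shows "(\<Sum>s\<in>{-5..5}. \<bar>vartheta \<nu> p s\<bar> * (real_of_int \<bar>s\<bar> * (real_of_int \<bar>s\<bar> + 5) / 4)) \<le> 1"
proof -
  have p6: "p div 2 \<le> 6" using p by auto
  have r: "{-5..5::int} = {-5,-4,-3,-2,-1,0,1,2,3,4,5}"
    by (simp add: set_eq_iff) presburger
  have "\<bar>vartheta \<nu> p s\<bar> \<le> (\<Sum>k<6. symbol_coeff 2 k * real (2 * k choose (k + nat \<bar>s\<bar>)))" for s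
  proof -
    have "\<bar>vartheta \<nu> p s\<bar> = (\<Sum>k<p div 2. symbol_coeff \<nu> k * real (2 * k choose (k + nat \<bar>s\<bar>)))"
      unfolding vartheta_eq[OF p] abs_mult power_abs
      using p6 nu by (auto intro!: abs_of_nonneg sum_nonneg mult_nonneg_nonneg symbol_coeff_nonneg)
    also have "\<dots> \<le> (\<Sum>k<6. symbol_coeff \<nu> k * real (2 * k choose (k + nat \<bar>s\<bar>)))"
      using p6 nu by (intro sum_mono2 mult_nonneg_nonneg symbol_coeff_nonneg) auto
    also have "\<dots> \<le> (\<Sum>k<6. symbol_coeff 2 k * real (2 * k choose (k + nat \<bar>s\<bar>)))"
      using nu by (intro sum_mono mult_right_mono symbol_coeff_mono) auto
    finally show ?thesis .
  qed
  then have "(\<Sum>s\<in>{-5..5}. \<bar>vartheta \<nu> p s\<bar> * (real_of_int \<bar>s\<bar> * (real_of_int \<bar>s\<bar> + 5) / 4)) \<le>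
      (\<Sum>s\<in>{-5..5}. (\<Sum>k<6. symbol_coeff 2 k * real (2 * k choose (k + nat \<bar>s\<bar>))) *
        (real_of_int \<bar>s\<bar> * (real_of_int \<bar>s\<bar> + 5) / 4))"
    by (intro sum_mono mult_right_mono) auto
  also have "\<dots> \<le> 1"
  proof -
    have "nat \<bar>-5 :: int\<bar> = 5" "nat \<bar>-4 :: int\<bar> = 4" "nat \<bar>-3 :: int\<bar> = 3"
      "nat \<bar>-2 :: int\<bar> = 2" "nat \<bar>-1 :: int\<bar> = 1" "nat \<bar>0 :: int\<bar> = 0" "nat \<bar>1 :: int\<bar> = 1"
      "nat \<bar>2 :: int\<bar> = 2" "nat \<bar>3 :: int\<bar> = 3" "nat \<bar>4 :: int\<bar> = 4" "nat \<bar>5 :: int\<bar> = 5"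
      by simp_all
    then show ?thesis
      unfolding r by (simp only: sum.insert_if finite.intros sum.empty insert_iff sum_central_binomials)
        (simp add: symbol_coeff_def)
  qed
  finally show ?thesis .
qed

section \<open>The Pade step of an accretive matrix\<close>

text \<open>
  For a real matrix that need not be symmetric this says that its symmetric part is positive
  semidefinite.
\<close>

abbreviation accretive :: "nat \<Rightarrow> real mat \<Rightarrow> bool" where
  "accretive N X \<equiv> X \<in> carrier_mat N N \<and> (\<forall>v \<in> carrier_vec N. 0 \<le> v \<bullet> (X *\<^sub>v v))"

lemma scalar_prod_self_nonneg: "0 \<le> v \<bullet> (v :: real vec)"
  unfolding scalar_prod_def by (intro sum_nonneg) simp

lemma scalar_prod_self_eq_0:
  assumes "v \<in> carrier_vec N" "v \<bullet> (v :: real vec) \<le> 0" shows "v = 0\<^sub>v N"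
proof
  have "(\<Sum>i\<in>{0..<N}. v $ i * v $ i) = 0"
    using scalar_prod_self_nonneg[of v] assms by (simp add: scalar_prod_def)
  then show "v $ i = 0\<^sub>v N $ i" if "i < dim_vec (0\<^sub>v N)" for i
    using that by (subst (asm) sum_nonneg_eq_0_iff) auto
qed (use assms in auto)

lemma
  assumes X: "X \<in> carrier_mat N N" and v: "v \<in> carrier_vec N"
  shows pade_den_mult_vec: "pade_den X *\<^sub>v v =
      (120 \<cdot>\<^sub>v v + 12 \<cdot>\<^sub>v (X *\<^sub>v (X *\<^sub>v v))) + (60 \<cdot>\<^sub>v (X *\<^sub>v v) + X *\<^sub>v (X *\<^sub>v (X *\<^sub>v v)))" (is ?den)
    and pade_num_mult_vec: "pade_num X *\<^sub>v v =
      (120 \<cdot>\<^sub>v v + 12 \<cdot>\<^sub>v (X *\<^sub>v (X *\<^sub>v v))) - (60 \<cdot>\<^sub>v (X *\<^sub>v v) + X *\<^sub>v (X *\<^sub>v (X *\<^sub>v v)))" (is ?num)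
proof -
  have X2: "X ^\<^sub>m 2 = X * X" and X3: "X ^\<^sub>m 3 = X * X * X"
    using X by (simp_all add: numeral_2_eq_2 numeral_3_eq_3)
  have sm: "(c \<cdot>\<^sub>m A) *\<^sub>v v = c \<cdot>\<^sub>v (A *\<^sub>v v)" if "A \<in> carrier_mat N N" for A c
    using that v by (intro eq_vecI) auto
  have c: "X * X \<in> carrier_mat N N" "X * X * X \<in> carrier_mat N N" using X by auto
  have Xv: "X *\<^sub>v v \<in> carrier_vec N" "X *\<^sub>v (X *\<^sub>v v) \<in> carrier_vec N"
     "X *\<^sub>v (X *\<^sub>v (X *\<^sub>v v)) \<in> carrier_vec N"
    using X v by auto
  have p: "(X * X) *\<^sub>v v = X *\<^sub>v (X *\<^sub>v v)" "(X * X * X) *\<^sub>v v = X *\<^sub>v (X *\<^sub>v (X *\<^sub>v v))"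
    using X v Xv by (simp_all add: assoc_mult_mat_vec[of _ N N _ N])
  have d: "dim_row X = N" using X by simp
  have regroup: "a + b + c + d = (a + c) + (b + d)" "a - b + c - d = (a + c) - (b + d)"
    if "a \<in> carrier_vec N" "b \<in> carrier_vec N" "c \<in> carrier_vec N" "d \<in> carrier_vec N"
    for a b c d :: "real vec"
    using that by (auto intro!: eq_vecI)
  define P where "P = 120 \<cdot>\<^sub>m 1\<^sub>m N + 60 \<cdot>\<^sub>m X"
  define M where "M = 120 \<cdot>\<^sub>m 1\<^sub>m N - 60 \<cdot>\<^sub>m X"
  have PM: "P \<in> carrier_mat N N" "M \<in> carrier_mat N N"
    using X by (auto simp: P_def M_def)
  have Pv: "P *\<^sub>v v = 120 \<cdot>\<^sub>v v + 60 \<cdot>\<^sub>v (X *\<^sub>v v)"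
    unfolding P_def using X v
    by (subst add_mult_distrib_mat_vec[of _ N N]) (simp_all add: sm del: index_mult_mat_vec)
  have Mv: "M *\<^sub>v v = 120 \<cdot>\<^sub>v v - 60 \<cdot>\<^sub>v (X *\<^sub>v v)"
    unfolding M_def using X v
    by (subst minus_mult_distrib_mat_vec[of _ N N]) (simp_all add: sm del: index_mult_mat_vec)
  have c12: "12 \<cdot>\<^sub>m (X * X) \<in> carrier_mat N N" using c by auto
  have sm12: "(12 \<cdot>\<^sub>m (X * X)) *\<^sub>v v = 12 \<cdot>\<^sub>v (X *\<^sub>v (X *\<^sub>v v))"
    using sm[OF c(1), of 12] unfolding p .
  have "pade_den X *\<^sub>v v = (P + 12 \<cdot>\<^sub>m (X * X)) *\<^sub>v v + X *\<^sub>v (X *\<^sub>v (X *\<^sub>v v))"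
    unfolding pade_den_def X2 X3 d P_def[symmetric] p(2)[symmetric]
    by (rule add_mult_distrib_mat_vec[OF add_carrier_mat[OF c12] c(2) v])
  also have "(P + 12 \<cdot>\<^sub>m (X * X)) *\<^sub>v v = P *\<^sub>v v + 12 \<cdot>\<^sub>v (X *\<^sub>v (X *\<^sub>v v))"
    unfolding sm12[symmetric] by (rule add_mult_distrib_mat_vec[OF PM(1) c12 v])
  also have "P *\<^sub>v v + 12 \<cdot>\<^sub>v (X *\<^sub>v (X *\<^sub>v v)) + X *\<^sub>v (X *\<^sub>v (X *\<^sub>v v)) =
      (120 \<cdot>\<^sub>v v + 12 \<cdot>\<^sub>v (X *\<^sub>v (X *\<^sub>v v))) + (60 \<cdot>\<^sub>v (X *\<^sub>v v) + X *\<^sub>v (X *\<^sub>v (X *\<^sub>v v)))"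
    unfolding Pv by (rule regroup) (use v Xv in simp_all)
  finally show ?den .
  have "pade_num X *\<^sub>v v = (M + 12 \<cdot>\<^sub>m (X * X)) *\<^sub>v v - X *\<^sub>v (X *\<^sub>v (X *\<^sub>v v))"
    unfolding pade_num_def X2 X3 d M_def[symmetric] p(2)[symmetric]
    by (rule minus_mult_distrib_mat_vec[OF add_carrier_mat[OF c12] c(2) v])
  also have "(M + 12 \<cdot>\<^sub>m (X * X)) *\<^sub>v v = M *\<^sub>v v + 12 \<cdot>\<^sub>v (X *\<^sub>v (X *\<^sub>v v))"
    unfolding sm12[symmetric] by (rule add_mult_distrib_mat_vec[OF PM(2) c12 v])
  also have "M *\<^sub>v v + 12 \<cdot>\<^sub>v (X *\<^sub>v (X *\<^sub>v v)) - X *\<^sub>v (X *\<^sub>v (X *\<^sub>v v)) =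
      (120 \<cdot>\<^sub>v v + 12 \<cdot>\<^sub>v (X *\<^sub>v (X *\<^sub>v v))) - (60 \<cdot>\<^sub>v (X *\<^sub>v v) + X *\<^sub>v (X *\<^sub>v (X *\<^sub>v v)))"
    unfolding Mv by (rule regroup) (use v Xv in simp_all)
  finally show ?num .
qed

lemma pade_carrier [simp, intro]:
  assumes "X \<in> carrier_mat N N"
  shows "pade_den X \<in> carrier_mat N N" "pade_num X \<in> carrier_mat N N"
  using assms by (auto simp: pade_den_def pade_num_def)

lemma pade_commute:
  assumes X: "X \<in> carrier_mat N N" and v: "v \<in> carrier_vec N"
  shows "pade_num X *\<^sub>v (pade_den X *\<^sub>v v) = pade_den X *\<^sub>v (pade_num X *\<^sub>v v)"
proof -
  have c: "X *\<^sub>v u \<in> carrier_vec N" if "u \<in> carrier_vec N" for u using X that by auto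
  note lin = mult_add_distrib_mat_vec[OF X] mult_minus_distrib_mat_vec[OF X] mult_mat_vec[OF X]
  show ?thesis
    using v c
    by (simp add: pade_den_mult_vec[OF X] pade_num_mult_vec[OF X] lin)
       (intro eq_vecI, auto simp: algebra_simps)
qed

text \<open>
  With \<open>E\<close> and \<open>F\<close> the even and odd parts applied to \<open>v\<close>, the difference of the two squared norms
  is four times \<open>E \<bullet> F\<close>, which the accretivity of \<open>X\<close> makes nonnegative after a decomposition into
  terms \<open>q \<bullet> X q\<close>.
\<close>

lemma pade_energy:
  assumes X: "accretive N X" and v: "v \<in> carrier_vec N"
  shows "(pade_num X *\<^sub>v v) \<bullet> (pade_num X *\<^sub>v v) \<le>
         (pade_den X *\<^sub>v v) \<bullet> (pade_den X *\<^sub>v v)"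
proof -
  have Xc: "X \<in> carrier_mat N N" using X by blast
  define x1 where "x1 = X *\<^sub>v v"
  define x2 where "x2 = X *\<^sub>v x1"
  define x3 where "x3 = X *\<^sub>v x2"
  define E where "E = 120 \<cdot>\<^sub>v v + 12 \<cdot>\<^sub>v x2"
  define F where "F = 60 \<cdot>\<^sub>v x1 + x3"
  \<comment> \<open>The vector \<open>(X\<^sup>2 + 10) v\<close> completes the products in \<open>E \<bullet> F\<close>.\<close>
  define q where "q = x2 + 10 \<cdot>\<^sub>v v"
  have c: "x1 \<in> carrier_vec N" "x2 \<in> carrier_vec N" "x3 \<in> carrier_vec N"
    using Xc v by (auto simp: x1_def x2_def x3_def)
  have cc: "E \<in> carrier_vec N" "F \<in> carrier_vec N" "q \<in> carrier_vec N"
    using c v by (auto simp: E_def F_def q_def)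
  note sp = add_scalar_prod_distrib[of _ N] scalar_prod_add_distrib[of _ N]
    minus_scalar_prod_distrib[of _ N] scalar_prod_minus_distrib[of _ N]
    smult_scalar_prod_distrib[of _ N] scalar_prod_smult_distrib[of _ N]
  have comm: "x2 \<bullet> v = v \<bullet> x2" "x2 \<bullet> x1 = x1 \<bullet> x2" "F \<bullet> E = E \<bullet> F"
    using c cc v by (auto intro: comm_scalar_prod)
  have Xq: "X *\<^sub>v q = x3 + 10 \<cdot>\<^sub>v x1"
    using Xc v c
    by (simp add: q_def x1_def[symmetric] x3_def[symmetric] mult_add_distrib_mat_vec[of _ N N] mult_mat_vec[of _ N N])
  have "(pade_den X *\<^sub>v v) \<bullet> (pade_den X *\<^sub>v v) - (pade_num X *\<^sub>v v) \<bullet> (pade_num X *\<^sub>v v)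
      = (E + F) \<bullet> (E + F) - (E - F) \<bullet> (E - F)"
    using Xc v by (simp add: pade_den_mult_vec[of _ N] pade_num_mult_vec[of _ N] E_def F_def x1_def x2_def x3_def)
  also have "\<dots> = 4 * (E \<bullet> F)"
    using cc comm by (simp add: sp)
  also have "E \<bullet> F = 12 * (q \<bullet> (X *\<^sub>v q)) + 6000 * (v \<bullet> x1) + 600 * (x1 \<bullet> x2)"
    unfolding Xq using v c comm by (simp add: E_def F_def q_def sp)
  finally have eq: "(pade_den X *\<^sub>v v) \<bullet> (pade_den X *\<^sub>v v) - (pade_num X *\<^sub>v v) \<bullet> (pade_num X *\<^sub>v v)
      = 4 * (12 * (q \<bullet> (X *\<^sub>v q)) + 6000 * (v \<bullet> x1) + 600 * (x1 \<bullet> x2))" .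
  have "0 \<le> q \<bullet> (X *\<^sub>v q)" "0 \<le> v \<bullet> x1" "0 \<le> x1 \<bullet> x2"
    using bspec[OF conjunct2[OF X] cc(3)] bspec[OF conjunct2[OF X] v] bspec[OF conjunct2[OF X] c(1)]
    unfolding x2_def by (simp_all add: x1_def)
  then have "0 \<le> 4 * (12 * (q \<bullet> (X *\<^sub>v q)) + 6000 * (v \<bullet> x1) + 600 * (x1 \<bullet> x2))" by simp
  then show ?thesis unfolding eq[symmetric] by simp
qed

text \<open>
  If the denominator annihilates \<open>v\<close> then, by \<open>pade_energy\<close>, so does the numerator, hence so do
  the even part \<open>12 (X\<^sup>2 + 10)\<close> and the odd part \<open>X (X\<^sup>2 + 60)\<close>, which are coprime
  polynomials in \<open>X\<close>.
\<close>

lemma pade_den_injective: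
  assumes X: "accretive N X" and v: "v \<in> carrier_vec N" and Dv: "pade_den X *\<^sub>v v = 0\<^sub>v N"
  shows "v = 0\<^sub>v N"
proof -
  have Xc: "X \<in> carrier_mat N N" using X by blast
  define x1 where "x1 = X *\<^sub>v v"
  define x2 where "x2 = X *\<^sub>v x1"
  define x3 where "x3 = X *\<^sub>v x2"
  have c: "x1 \<in> carrier_vec N" "x2 \<in> carrier_vec N" "x3 \<in> carrier_vec N"
    using Xc v by (auto simp: x1_def x2_def x3_def)
  have Nc: "pade_num X *\<^sub>v v \<in> carrier_vec N"
    using pade_carrier(2)[OF Xc] v by auto
  have "(pade_num X *\<^sub>v v) \<bullet> (pade_num X *\<^sub>v v) \<le> 0"
    using pade_energy[OF X v] unfolding Dv by simp
  with Nc have Nv: "pade_num X *\<^sub>v v = 0\<^sub>v N" by (rule scalar_prod_self_eq_0)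
  have EF: "120 * v $ i + 12 * x2 $ i = 0 \<and> 60 * x1 $ i + x3 $ i = 0" if "i < N" for i
  proof -
    have "(pade_den X *\<^sub>v v) $ i = 0" "(pade_num X *\<^sub>v v) $ i = 0"
      unfolding Dv Nv using that by auto
    then have "(120 * v $ i + 12 * x2 $ i) + (60 * x1 $ i + x3 $ i) = 0"
        "(120 * v $ i + 12 * x2 $ i) - (60 * x1 $ i + x3 $ i) = 0"
      using that c v unfolding pade_den_mult_vec[OF Xc v] pade_num_mult_vec[OF Xc v]
        x1_def[symmetric] x2_def[symmetric] x3_def[symmetric] by auto
    then show ?thesis by linarith
  qed
  have x2: "x2 = - 10 \<cdot>\<^sub>v v"
    using c v EF by (intro eq_vecI) (force simp: field_simps)+
  have x3: "x3 = - 10 \<cdot>\<^sub>v x1"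
    unfolding x3_def x2 x1_def by (rule mult_mat_vec[OF Xc v])
  have "x1 = 0\<^sub>v N"
    using c EF unfolding x3 by (intro eq_vecI) fastforce+
  then have "x2 = 0\<^sub>v N" using Xc by (auto simp: x2_def)
  show ?thesis
  proof
    fix i assume "i < dim_vec (0\<^sub>v N)"
    then have i: "i < N" by simp
    have "x2 $ i = 0" using \<open>x2 = 0\<^sub>v N\<close> i by simp
    with EF[OF i] i show "v $ i = 0\<^sub>v N $ i" by simp
  qed (use v in auto)
qed

lemma pade_den_invertible:
  assumes X: "accretive N X"
  shows "invertible_mat (pade_den X)"
    and "\<exists>B \<in> carrier_mat N N. mat_inverse (pade_den X) = Some B \<and>
           pade_den X * B = 1\<^sub>m N \<and> B * pade_den X = 1\<^sub>m N"
proof -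
  have D: "pade_den X \<in> carrier_mat N N" using X by auto
  have "det (pade_den X) \<noteq> 0"
    using pade_den_injective[OF X] det_0_iff_vec_prod_zero_field[OF D] by blast
  then have unit: "pade_den X \<in> Units (ring_mat TYPE(real) N ())"
    by (rule det_non_zero_imp_unit[OF D])
  then obtain B where inv: "mat_inverse (pade_den X) = Some B"
    using mat_inverse(1)[OF D, where b = "()"] by (cases "mat_inverse (pade_den X)") auto
  from mat_inverse(2)[OF D this]
  have B: "pade_den X * B = 1\<^sub>m N" "B * pade_den X = 1\<^sub>m N" "B \<in> carrier_mat N N" by auto
  then show "\<exists>B \<in> carrier_mat N N. mat_inverse (pade_den X) = Some B \<and>
           pade_den X * B = 1\<^sub>m N \<and> B * pade_den X = 1\<^sub>m N"
    using inv by blast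
  have "square_mat (pade_den X)" using D by auto
  moreover have "inverts_mat (pade_den X) B" "inverts_mat B (pade_den X)"
    using B D by (auto simp: inverts_mat_def)
  ultimately show "invertible_mat (pade_den X)" unfolding invertible_mat_def by blast
qed

text \<open>
  The energy estimate compares numerator and denominator at the same vector.  Since they
  commute, the step maps \<open>v = pade_den X *\<^sub>v u\<close> to \<open>pade_num X *\<^sub>v u\<close>.
\<close>

lemma pade_step_contraction:
  assumes X: "accretive N X" and v: "v \<in> carrier_vec N"
  shows "pade_step X *\<^sub>v v \<in> carrier_vec N"
    and "(pade_step X *\<^sub>v v) \<bullet> (pade_step X *\<^sub>v v) \<le> v \<bullet> v"
proof -
  have Xc: "X \<in> carrier_mat N N" using X by blast
  note D = pade_carrier(1)[OF Xc] and P = pade_carrier(2)[OF Xc]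
  obtain B where B: "B \<in> carrier_mat N N" "mat_inverse (pade_den X) = Some B"
      "pade_den X * B = 1\<^sub>m N" "B * pade_den X = 1\<^sub>m N"
    using pade_den_invertible(2)[OF X] by blast
  define u where "u = B *\<^sub>v v"
  have u: "u \<in> carrier_vec N" using B v by (auto simp: u_def)
  have Du: "pade_den X *\<^sub>v u = v"
    using assoc_mult_mat_vec[OF D B(1) v] v by (simp add: u_def B(3))
  have Pu: "pade_num X *\<^sub>v u \<in> carrier_vec N" using P u by auto
  have "pade_step X *\<^sub>v v = B *\<^sub>v (pade_num X *\<^sub>v (pade_den X *\<^sub>v u))"
    unfolding Du pade_step_def B(2) option.sel by (rule assoc_mult_mat_vec[OF B(1) P v])
  also have "\<dots> = (B * pade_den X) *\<^sub>v (pade_num X *\<^sub>v u)"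
    unfolding pade_commute[OF Xc u] by (rule assoc_mult_mat_vec[OF B(1) D Pu, symmetric])
  also have "\<dots> = pade_num X *\<^sub>v u" unfolding B(4) using Pu by simp
  finally have eq: "pade_step X *\<^sub>v v = pade_num X *\<^sub>v u" .
  show "pade_step X *\<^sub>v v \<in> carrier_vec N" unfolding eq by (rule Pu)
  show "(pade_step X *\<^sub>v v) \<bullet> (pade_step X *\<^sub>v v) \<le> v \<bullet> v"
    using pade_energy[OF X u] unfolding eq Du .
qed

lemma norm2h_eq: "norm2h h V = sqrt (h * (V \<bullet> V))"
  by (simp add: norm2h_def scalar_prod_def power2_eq_square atLeast0LessThan)

lemma unconditionally_stable_if_accretive:
  assumes L: "L > 0" and X: "\<And>m n. m \<ge> 2 \<Longrightarrow> n \<ge> 1 \<Longrightarrow> accretive (m - 1) (X m n)"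
  shows "unconditionally_stable L T (\<lambda>m n. pade_step (X m n))"
proof -
  have main: "norm2h (L / real m) (U j) \<le> norm2h (L / real m) (U 0)"
    if m: "2 \<le> m" and n: "1 \<le> n" and jn: "j \<le> n"
    and U: "U 0 \<in> carrier_vec (m - 1) \<and> (\<forall>j<n. U (Suc j) = pade_step (X m n) *\<^sub>v U j)"
    for m n j :: nat and U :: "nat \<Rightarrow> real vec"
  proof -
    note c = pade_step_contraction[OF X[OF m n]]
    have "U j \<in> carrier_vec (m - 1) \<and> U j \<bullet> U j \<le> U 0 \<bullet> U 0"
      using jn
    proof (induction j)
      case (Suc j)
      then have IH: "U j \<in> carrier_vec (m - 1)" "U j \<bullet> U j \<le> U 0 \<bullet> U 0" by auto
      have "U (Suc j) = pade_step (X m n) *\<^sub>v U j" using U Suc.prems by auto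
      then show ?case using c[OF IH(1)] IH(2) by auto
    qed (use U in auto)
    then show ?thesis
      using L m unfolding norm2h_eq by (simp add: mult_left_mono divide_right_mono)
  qed
  show ?thesis
    unfolding unconditionally_stable_def
    apply (rule exI[of _ 1], rule conjI, simp)
    apply (rule exI[of _ 0], rule conjI, simp)
    using main by (simp only: mult_zero_left exp_zero mult_1_left) blast
qed

lemma accretive_add:
  assumes "accretive N X" "accretive N Y" shows "accretive N (X + Y)"
  using assms by (auto simp: add_mult_distrib_mat_vec[of _ N N] scalar_prod_add_distrib[of _ N])

lemma accretive_smult:
  assumes X: "accretive N X" and c: "c \<ge> 0" shows "accretive N (c \<cdot>\<^sub>m X)"
proof -
  have "v \<bullet> ((c \<cdot>\<^sub>m X) *\<^sub>v v) = c * (v \<bullet> (X *\<^sub>v v))" if v: "v \<in> carrier_vec N" for v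
  proof -
    have "(c \<cdot>\<^sub>m X) *\<^sub>v v = c \<cdot>\<^sub>v (X *\<^sub>v v)" using X v by (intro eq_vecI) auto
    then show ?thesis using X v by auto
  qed
  then show ?thesis using X c by auto
qed

section \<open>Accretivity of the space discretisation\<close>

text \<open>
  A vector is extended by zero to a grid function \<open>u\<close>.  By \<open>omega_eq_g\<close> the matrix \<open>M\<close> then
  produces a nonnegative multiple of the potential of \<open>u\<close>, and \<open>quadratic_form_nonneg\<close> applies
  with band width 5, which suffices for all \<open>p\<close>.
\<close>

lemma accretive_A_M:
  assumes p: "p \<in> {2, 4, 6, 8, 10, 12}" and nu: "0 < \<nu>" "\<nu> \<le> 2" and K: "\<K> \<ge> 0"
  shows "accretive (m - 1) (A_mat p \<nu> m * M_mat \<K> \<nu> h m)"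
proof -
  define N where "N = m - 1"
  define A where "A = A_mat p \<nu> m"
  define M where "M = M_mat \<K> \<nu> h m"
  have A: "A \<in> carrier_mat N N" and M: "M \<in> carrier_mat N N"
    by (simp_all add: A_def M_def A_mat_def M_mat_def N_def)
  interpret fractional_difference "\<nu> / 2" by standard (use nu in auto)
  define c where "c = \<K> * h powr (- \<nu>) * (omega \<nu> 0 / g 0)"
  have c: "c \<ge> 0"
    using K omega_0_pos g_0_ge_1 by (auto simp: c_def intro!: mult_nonneg_nonneg)
  have ints: "sum f {0..<int N} = (\<Sum>i<N. f (int i))" for f :: "int \<Rightarrow> real"
    by (rule sum.reindex_bij_witness[where i = int and j = nat]) auto
  have "0 \<le> v \<bullet> (A * M *\<^sub>v v)" if v: "v \<in> carrier_vec N" for v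
  proof -
    define u where "u i = (if i \<in> {0..<int N} then v $ nat i else 0)" for i
    have Mv: "(M *\<^sub>v v) $ i = c * potential N u (int i)" if "i < N" for i
    proof -
      have "(M *\<^sub>v v) $ i = (\<Sum>j<N. \<K> * h powr (- \<nu>) * omega \<nu> \<bar>int i - int j\<bar> * v $ j)"
        using that v M by (simp add: scalar_prod_def M_def M_mat_def N_def atLeast0LessThan)
      also have "\<dots> = c * potential N u (int i)"
        unfolding potential_def ints sum_distrib_left
        using omega_eq_g by (intro sum.cong) (auto simp: u_def c_def)
      finally show ?thesis .
    qed
    have "v \<bullet> (A * M *\<^sub>v v) = (\<Sum>i<N. \<Sum>j<N. v $ i * (vartheta \<nu> p \<bar>int i - int j\<bar> * (M *\<^sub>v v) $ j))"
    proof -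
      have "dim_vec (M *\<^sub>v v) = N" using M by simp
      then have "(A *\<^sub>v (M *\<^sub>v v)) $ i = (\<Sum>j<N. vartheta \<nu> p \<bar>int i - int j\<bar> * (M *\<^sub>v v) $ j)"
        if "i < N" for i
        using that unfolding A_def A_mat_def N_def[symmetric]
        by (simp add: scalar_prod_def[of _ "M *\<^sub>v v"] atLeast0LessThan del: index_mult_mat_vec)
           (simp add: scalar_prod_def[of _ "M *\<^sub>v v"] atLeast0LessThan)
      then show ?thesis
        unfolding assoc_mult_mat_vec[OF A M v] scalar_prod_def[of v] using A
        by (simp add: atLeast0LessThan sum_distrib_left del: index_mult_mat_vec)
    qed
    also have "\<dots> = (\<Sum>j<N. \<Sum>i<N. c * (vartheta \<nu> p (int j - int i) * u (int i) * potential N u (int j)))"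
    proof (subst sum.swap, intro sum.cong refl)
      fix i j assume "i \<in> {..<N}" "j \<in> {..<N}"
      moreover have "vartheta \<nu> p \<bar>int i - int j\<bar> = vartheta \<nu> p (int j - int i)"
        by (simp only: vartheta_def abs_idempotent abs_minus_commute[of "int i" "int j"])
      ultimately show "v $ i * (vartheta \<nu> p \<bar>int i - int j\<bar> * (M *\<^sub>v v) $ j) =
          c * (vartheta \<nu> p (int j - int i) * u (int i) * potential N u (int j))"
        by (simp add: Mv u_def del: index_mult_mat_vec)
    qed
    also have "\<dots> = c * (\<Sum>i\<in>{0..<int N}. (\<Sum>j\<in>{0..<int N}. vartheta \<nu> p (i - j) * u j) * potential N u i)"
      unfolding ints by (simp add: sum_distrib_left sum_distrib_right)
    also have "\<dots> \<ge> 0"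
    proof (intro mult_nonneg_nonneg c quadratic_form_nonneg[where K = 5])
      show "vartheta \<nu> p s = 0" if "\<bar>s\<bar> > 5" for s
        using that p by (auto simp: vartheta_def Let_def length_vartheta_list)
      show "correlation N u 0 \<le> (\<Sum>s\<in>{-5..5}. vartheta \<nu> p s * correlation N u s)"
        using p nu by (intro vartheta_symbol autocorrelation_correlation) auto
      show "(\<Sum>s\<in>{-5..5}. \<bar>vartheta \<nu> p s\<bar> * (real_of_int \<bar>s\<bar> * (real_of_int \<bar>s\<bar> + 5) / 4)) \<le> 1"
        using p nu by (intro vartheta_small) auto
    qed (auto simp: u_def)
    finally show ?thesis .
  qed
  then have "accretive N (A * M)" using mult_carrier_mat[OF A M] by blast
  then show ?thesis unfolding A_def M_def N_def .
qed

theorem theorem4p1: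
  fixes L T \<alpha> \<beta> \<K>\<alpha> \<K>\<beta> :: real and p :: nat
  assumes "L > 0" and "T > 0"
    and "1 < \<alpha>" and "\<alpha> \<le> 2"
    and "0 < \<beta>" and "\<beta> < 1"
    and "\<K>\<alpha> > 0" and "\<K>\<beta> \<ge> 0"
    and "p \<in> {2, 4, 6, 8, 10, 12}"
  defines "kS \<equiv> \<lambda>m n. (T / real n) \<cdot>\<^sub>m S_mat p \<alpha> \<beta> \<K>\<alpha> \<K>\<beta> (L / real m) m"
  shows "(\<forall>m\<ge>2. \<forall>n\<ge>1. invertible_mat (pade_den (kS m n))) \<and>
         unconditionally_stable L T (\<lambda>m n. pade_step (kS m n))"
proof -
  have kS: "accretive (m - 1) (kS m n)" for m n
    unfolding kS_def S_mat_def using assms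
    by (intro accretive_smult accretive_add accretive_A_M) auto
  then show ?thesis
    using pade_den_invertible(1) unconditionally_stable_if_accretive[OF assms(1)] by blast
qed

end
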